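(* Let $\Delta$ be an irreducible root system of rank $n$, with positive roots $\Delta^+$ ordered by the root order. Then: (i) $\deg\mathcal K^{u}_{\Delta^+}\le 3$ and $\deg\mathcal K^{l}_{\Delta^+}\le 3$; (ii) the coefficients of $q^3$ in $\mathcal K^{u}_{\Delta^+}$ and in $\mathcal K^{l}_{\Delta^+}$ are equal; (iii) if $\Delta$ is simply-laced, the coefficient of $q$ in $\mathcal K^{u}_{\Delta^+}$ equals the coefficient of $q^3$ in $\mathcal K^{u}_{\Delta^+}$; (iv) $D_{\Delta^+}(q)\equiv n-1$.
   Context: Here irreducible root systems include the non-reduced system $BC_n$ (whose roots in $\mathbb R^n$ with orthonormal basis $\varepsilon_1,\dots,\varepsilon_n$ are $\pm\varepsilon_i\pm\varepsilon_j$ ($i<j$), $\pm\varepsilon_i$, $\pm2\varepsilon_i$). Fix a set of positive roots $\Delta^+$ with simple roots $\Pi$. The root order on $\Delta^+$ is the partial order in which $\gamma$ covers $\mu$ if and only if $\gamma-\mu\in\Pi$. For a finite poset $\mathcal P$ and $x\in\mathcal P$, $\kappa(x)$ is the number of elements covered by $x$ and $\iota(x)$ the number of elements covering $x$; $\mathcal K^{u}_{\mathcal P}(q)=\sum_{x}q^{\kappa(x)}$, $\mathcal K^{l}_{\mathcal P}(q)=\sum_x q^{\iota(x)}$, and the deviation polynomial $D_{\mathcal P}$ is defined by $\mathcal K^{u}_{\mathcal P}-\mathcal K^{l}_{\mathcal P}=(q-1)^2D_{\mathcal P}$. *)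

theory Defs
  imports "HOL-Analysis.Analysis" "HOL-Computational_Algebra.Polynomial"
begin

section \<open>Finite posets: covering statistics and the deviation polynomial\<close>

text \<open>
  A poset is given by its carrier \<open>X\<close> and its (reflexive) order \<open>r\<close>, where \<open>(x, y) \<in> r\<close> means
  that \<open>x\<close> is below \<open>y\<close>; see \<^const>\<open>partial_order_on\<close>.
\<close>

definition covers :: "'a set \<Rightarrow> 'a rel \<Rightarrow> 'a \<Rightarrow> 'a \<Rightarrow> bool" where
  "covers X r x y \<longleftrightarrow> x \<in> X \<and> y \<in> X \<and> (y, x) \<in> r \<and> y \<noteq> x \<and>
     \<not> (\<exists>z\<in>X. (y, z) \<in> r \<and> (z, x) \<in> r \<and> z \<noteq> x \<and> z \<noteq> y)"

definition kappa :: "'a set \<Rightarrow> 'a rel \<Rightarrow> 'a \<Rightarrow> nat" where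
  "kappa X r x = card {y \<in> X. covers X r x y}"

definition iota :: "'a set \<Rightarrow> 'a rel \<Rightarrow> 'a \<Rightarrow> nat" where
  "iota X r x = card {y \<in> X. covers X r y x}"

definition upper_poly :: "'a set \<Rightarrow> 'a rel \<Rightarrow> int poly" where
  "upper_poly X r = (\<Sum>x\<in>X. monom 1 (kappa X r x))"

definition lower_poly :: "'a set \<Rightarrow> 'a rel \<Rightarrow> int poly" where
  "lower_poly X r = (\<Sum>x\<in>X. monom 1 (iota X r x))"

text \<open>
  Here \<open>[:-1, 1:]\<close> is the polynomial \<open>q - 1\<close>. For finite \<open>X\<close> the description is proper:
  existence is shown in \<open>deviation_poly_eq\<close> below, and uniqueness holds as \<open>int poly\<close> is a domain.
\<close>

definition deviation_poly :: "'a set \<Rightarrow> 'a rel \<Rightarrow> int poly" where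
  "deviation_poly X r = (THE D. upper_poly X r - lower_poly X r = [:-1, 1:] ^ 2 * D)"

lemma sum_kappa_eq_sum_iota:
  assumes "finite X"
  shows "(\<Sum>x\<in>X. kappa X r x) = (\<Sum>x\<in>X. iota X r x)"
proof -
  have "(\<Sum>x\<in>X. kappa X r x) = (\<Sum>x\<in>X. \<Sum>y\<in>X. if covers X r x y then 1 else 0)"
    unfolding kappa_def using assms by (intro sum.cong refl) (simp add: sum.If_cases Int_def)
  also have "\<dots> = (\<Sum>y\<in>X. \<Sum>x\<in>X. if covers X r x y then 1 else 0)"
    by (rule sum.swap)
  also have "\<dots> = (\<Sum>y\<in>X. iota X r y)"
    unfolding iota_def using assms by (intro sum.cong refl) (simp add: sum.If_cases Int_def)
  finally show ?thesis .
qed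

lemma monom_minus_linear_dvd:
  "([:-1, 1:] :: int poly) ^ 2 dvd monom 1 k - [:1 - int k, int k:]"
proof (induction k)
  case 0
  show ?case by (simp add: monom_0)
next
  case (Suc k)
  have "monom 1 (Suc k) - [:1 - int (Suc k), int (Suc k):]
      = [:0, 1:] * (monom 1 k - [:1 - int k, int k:]) + [:-1, 1:] ^ 2 * [:int k:]"
    by (simp add: monom_Suc algebra_simps power2_eq_square)
  then show ?case
    using Suc by (simp only:) (intro dvd_add dvd_mult dvd_triv_left)
qed

lemma deviation_poly_eq:
  assumes "finite X"
  shows "upper_poly X r - lower_poly X r = [:-1, 1:] ^ 2 * deviation_poly X r"
proof -
  let ?L = "\<lambda>k::nat. [:1 - int k, int k:]"
  have lin: "(\<Sum>x\<in>X. ?L (f x)) = [:int (card X) - int (sum f X), int (sum f X):]" for f :: "'a \<Rightarrow> nat"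
    using assms by (induction X rule: finite_induct) auto
  have "upper_poly X r - lower_poly X r
      = (\<Sum>x\<in>X. monom 1 (kappa X r x) - ?L (kappa X r x))
        - (\<Sum>x\<in>X. monom 1 (iota X r x) - ?L (iota X r x))"
    unfolding upper_poly_def lower_poly_def sum_subtractf lin sum_kappa_eq_sum_iota[OF assms]
    by simp
  moreover have "([:-1, 1:] :: int poly) ^ 2 dvd \<dots>"
    by (intro dvd_diff dvd_sum monom_minus_linear_dvd)
  ultimately obtain D where D: "upper_poly X r - lower_poly X r = [:-1, 1:] ^ 2 * D"
    by (metis dvdE)
  moreover have "D' = D" if "upper_poly X r - lower_poly X r = [:-1, 1:] ^ 2 * D'" for D'
    using that D by simp
  ultimately have "deviation_poly X r = D"
    unfolding deviation_poly_def by (rule the_equality)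
  then show ?thesis
    using D by simp
qed

section \<open>Root systems\<close>

text \<open>
  Crystallographic root systems spanning the Euclidean space \<open>'a\<close>. Reducedness is not required,
  so that the systems of type \<open>BC\<close> are included.
\<close>

definition root_system :: "'a::euclidean_space set \<Rightarrow> bool" where
  "root_system \<Delta> \<longleftrightarrow> finite \<Delta> \<and> 0 \<notin> \<Delta> \<and> span \<Delta> = UNIV \<and>
     (\<forall>\<alpha>\<in>\<Delta>. \<forall>\<beta>\<in>\<Delta>. \<beta> - (2 * (\<beta> \<bullet> \<alpha>) / (\<alpha> \<bullet> \<alpha>)) *\<^sub>R \<alpha> \<in> \<Delta>) \<and>
     (\<forall>\<alpha>\<in>\<Delta>. \<forall>\<beta>\<in>\<Delta>. 2 * (\<beta> \<bullet> \<alpha>) / (\<alpha> \<bullet> \<alpha>) \<in> \<int>)"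

definition irreducible_root_system :: "'a::euclidean_space set \<Rightarrow> bool" where
  "irreducible_root_system \<Delta> \<longleftrightarrow> root_system \<Delta> \<and> \<Delta> \<noteq> {} \<and>
     \<not> (\<exists>A B. A \<noteq> {} \<and> B \<noteq> {} \<and> \<Delta> = A \<union> B \<and> (\<forall>\<alpha>\<in>A. \<forall>\<beta>\<in>B. \<alpha> \<bullet> \<beta> = 0))"

definition simply_laced :: "'a::euclidean_space set \<Rightarrow> bool" where
  "simply_laced \<Delta> \<longleftrightarrow> (\<forall>\<alpha>\<in>\<Delta>. \<forall>\<beta>\<in>\<Delta>. norm \<alpha> = norm \<beta>)"

definition positive_roots :: "'a::euclidean_space set \<Rightarrow> 'a set \<Rightarrow> bool" where
  "positive_roots \<Delta> P \<longleftrightarrow>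
     (\<exists>v. (\<forall>\<alpha>\<in>\<Delta>. v \<bullet> \<alpha> \<noteq> 0) \<and> P = {\<alpha> \<in> \<Delta>. v \<bullet> \<alpha> > 0})"

text \<open>The two summands may coincide: in type \<open>BC\<close> the root \<open>2\<epsilon>\<^sub>n = \<epsilon>\<^sub>n + \<epsilon>\<^sub>n\<close> is not simple.\<close>

definition simple_roots :: "'a::euclidean_space set \<Rightarrow> 'a set" where
  "simple_roots P = {\<alpha> \<in> P. \<not> (\<exists>\<beta>\<in>P. \<exists>\<gamma>\<in>P. \<alpha> = \<beta> + \<gamma>)}"

text \<open>
  The order is generated by its prescribed covering pairs; \<open>covers_root_order_iff\<close> below
  confirms that it has no other covering pairs and loses none of them.
\<close>

definition root_order :: "'a::euclidean_space set \<Rightarrow> 'a rel" where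
  "root_order P = {(\<mu>, \<gamma>) \<in> P \<times> P. \<gamma> - \<mu> \<in> simple_roots P}\<^sup>* \<inter> P \<times> P"

lemma root_order_step_less:
  assumes "(\<mu>, \<gamma>) \<in> {(\<mu>, \<gamma>) \<in> P \<times> P. \<gamma> - \<mu> \<in> simple_roots P}\<^sup>*" "\<forall>\<alpha>\<in>P. v \<bullet> \<alpha> > 0"
  shows "\<mu> = \<gamma> \<or> v \<bullet> \<mu> < v \<bullet> \<gamma>"
  using assms(1)
proof (induction rule: rtrancl_induct)
  case base
  then show ?case by simp
next
  case (step y z)
  then have "v \<bullet> (z - y) > 0"
    using assms(2) by (auto simp: simple_roots_def)
  then show ?case using step.IH by (auto simp: inner_diff_right)
qed

lemma partial_order_on_root_order:
  assumes "positive_roots \<Delta> P"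
  shows "partial_order_on P (root_order P)"
proof -
  obtain v where v: "\<forall>\<alpha>\<in>P. v \<bullet> \<alpha> > 0"
    using assms by (auto simp: positive_roots_def)
  show ?thesis
    unfolding partial_order_on_def preorder_on_def
  proof (intro conjI)
    show "antisym (root_order P)"
    proof (rule antisymI)
      fix x y
      assume "(x, y) \<in> root_order P" "(y, x) \<in> root_order P"
      then have "x = y \<or> v \<bullet> x < v \<bullet> y" "y = x \<or> v \<bullet> y < v \<bullet> x"
        using root_order_step_less[OF _ v] unfolding root_order_def Int_iff by blast+
      then show "x = y" by auto
    qed
    show "trans (root_order P)"
      unfolding root_order_def by (intro trans_Int trans_rtrancl) (auto simp: trans_def)
  qed (auto simp: root_order_def refl_on_def)
qed

lemma root_system_uminus:
  assumes "root_system \<Delta>" "\<alpha> \<in> \<Delta>"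
  shows "- \<alpha> \<in> \<Delta>"
proof -
  have "\<alpha> \<noteq> 0" "\<alpha> - (2 * (\<alpha> \<bullet> \<alpha>) / (\<alpha> \<bullet> \<alpha>)) *\<^sub>R \<alpha> \<in> \<Delta>"
    using assms unfolding root_system_def by blast+
  then show ?thesis by (simp add: scaleR_2)
qed

lemma root_system_diff:
  assumes rs: "root_system \<Delta>" and "\<alpha> \<in> \<Delta>" "\<beta> \<in> \<Delta>" "\<alpha> \<bullet> \<beta> > 0" "\<alpha> \<noteq> \<beta>"
  shows "\<alpha> - \<beta> \<in> \<Delta>"
proof -
  have refl: "\<And>x y. x \<in> \<Delta> \<Longrightarrow> y \<in> \<Delta> \<Longrightarrow> y - (2 * (y \<bullet> x) / (x \<bullet> x)) *\<^sub>R x \<in> \<Delta>"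
    and int: "\<And>x y. x \<in> \<Delta> \<Longrightarrow> y \<in> \<Delta> \<Longrightarrow> 2 * (y \<bullet> x) / (x \<bullet> x) \<in> \<int>"
    and "0 \<notin> \<Delta>"
    using rs unfolding root_system_def by blast+
  then have pos: "\<alpha> \<bullet> \<alpha> > 0" "\<beta> \<bullet> \<beta> > 0"
    using assms by auto
  define a b where "a = 2 * (\<alpha> \<bullet> \<beta>) / (\<beta> \<bullet> \<beta>)" and "b = 2 * (\<beta> \<bullet> \<alpha>) / (\<alpha> \<bullet> \<alpha>)"
  have ab: "a > 0" "b > 0"
    unfolding a_def b_def using assms pos by (simp_all add: inner_commute)
  obtain k l :: int where kl: "a = of_int k" "b = of_int l"
    using int assms unfolding a_def b_def by (metis Ints_cases)
  have "a = 1 \<or> b = 1"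
  proof (rule ccontr)
    assume "\<not> ?thesis"
    then have "k \<ge> 2" "l \<ge> 2" using ab kl by auto
    then have "a \<ge> 2" "b \<ge> 2" using kl by auto
    then have "\<beta> \<bullet> \<beta> \<le> \<alpha> \<bullet> \<beta>" "\<alpha> \<bullet> \<alpha> \<le> \<alpha> \<bullet> \<beta>"
      unfolding a_def b_def using pos by (simp_all add: field_simps inner_commute)
    then have "(\<alpha> - \<beta>) \<bullet> (\<alpha> - \<beta>) \<le> 0"
      by (simp add: inner_diff inner_commute)
    then show False using \<open>\<alpha> \<noteq> \<beta>\<close> by (simp flip: not_less)
  qed
  then show ?thesis
  proof
    assume "a = 1"
    then show ?thesis using refl[of \<beta> \<alpha>] assms(2,3) by (simp only: a_def scaleR_one)
  next
    assume "b = 1"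
    then have "\<beta> - \<alpha> \<in> \<Delta>" using refl[of \<alpha> \<beta>] assms(2,3) by (simp only: b_def scaleR_one)
    then show ?thesis using root_system_uminus[OF rs, of "\<beta> - \<alpha>"] by simp
  qed
qed

lemma simple_roots_inner_nonpos:
  assumes rs: "root_system \<Delta>" and P: "positive_roots \<Delta> P"
    and s: "\<alpha> \<in> simple_roots P" "\<beta> \<in> simple_roots P" "\<alpha> \<noteq> \<beta>"
  shows "\<alpha> \<bullet> \<beta> \<le> 0"
proof (rule ccontr)
  assume nonpos: "\<not> ?thesis"
  obtain v where v: "\<forall>\<alpha>\<in>\<Delta>. v \<bullet> \<alpha> \<noteq> 0" "P = {\<alpha> \<in> \<Delta>. v \<bullet> \<alpha> > 0}"
    using P by (auto simp: positive_roots_def)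
  have "\<alpha> \<in> P" "\<beta> \<in> P" using s by (auto simp: simple_roots_def)
  then have "\<alpha> - \<beta> \<in> \<Delta>"
    using root_system_diff[OF rs, of \<alpha> \<beta>] nonpos s(3) v(2) by auto
  moreover from this have "\<beta> - \<alpha> \<in> \<Delta>"
    using root_system_uminus[OF rs, of "\<alpha> - \<beta>"] by simp
  moreover have "v \<bullet> (\<alpha> - \<beta>) = - (v \<bullet> (\<beta> - \<alpha>))"
    by (simp add: inner_diff_right)
  ultimately consider "\<alpha> - \<beta> \<in> P" | "\<beta> - \<alpha> \<in> P"
    unfolding v(2) using v(1)[rule_format, of "\<alpha> - \<beta>"] by force
  then show False
  proof cases
    case 1
    moreover have "\<alpha> = (\<alpha> - \<beta>) + \<beta>" by simp
    ultimately show False using s \<open>\<beta> \<in> P\<close> unfolding simple_roots_def by blast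
  next
    case 2
    moreover have "\<beta> = (\<beta> - \<alpha>) + \<alpha>" by simp
    ultimately show False using s \<open>\<alpha> \<in> P\<close> unfolding simple_roots_def by blast
  qed
qed

lemma root_order_inner:
  assumes "root_system \<Delta>" "positive_roots \<Delta> P" "\<alpha> \<in> simple_roots P"
    and "(\<mu>, \<gamma>) \<in> {(\<mu>, \<gamma>) \<in> P \<times> P. \<gamma> - \<mu> \<in> simple_roots P}\<^sup>*"
    and v: "\<forall>\<beta>\<in>P. v \<bullet> \<beta> > 0"
  shows "(\<gamma> - \<mu>) \<bullet> \<alpha> \<le> 0 \<or> v \<bullet> (\<gamma> - \<mu>) \<ge> v \<bullet> \<alpha>"
  using assms(4)
proof (induction rule: rtrancl_induct)
  case base
  then show ?case by simp
next
  case (step y z)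
  from step have "z - y \<in> simple_roots P" by auto
  moreover have "v \<bullet> (z - y) > 0" using v calculation by (auto simp: simple_roots_def)
  moreover have "v \<bullet> (y - \<mu>) \<ge> 0"
    using root_order_step_less[OF step.hyps(1) v] by (auto simp: inner_diff_right)
  moreover have "(z - y) \<bullet> \<alpha> \<le> 0" if "z - y \<noteq> \<alpha>"
    using simple_roots_inner_nonpos[OF assms(1,2) calculation(1) assms(3) that] .
  moreover have "z - \<mu> = (z - y) + (y - \<mu>)" by simp
  ultimately show ?case
    using step.IH by (smt (verit) inner_add_left inner_add_right)
qed

lemma covers_root_order_iff:
  assumes rs: "root_system \<Delta>" and P: "positive_roots \<Delta> P"
  shows "covers P (root_order P) \<gamma> \<mu> \<longleftrightarrow> \<gamma> \<in> P \<and> \<mu> \<in> P \<and> \<gamma> - \<mu> \<in> simple_roots P"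
proof
  let ?S = "{(\<mu>, \<gamma>) \<in> P \<times> P. \<gamma> - \<mu> \<in> simple_roots P}"
  obtain v where v: "\<forall>\<alpha>\<in>P. v \<bullet> \<alpha> > 0"
    using P by (auto simp: positive_roots_def)
  {
    assume c: "covers P (root_order P) \<gamma> \<mu>"
    then have "(\<mu>, \<gamma>) \<in> ?S\<^sup>*" "\<mu> \<noteq> \<gamma>" and P': "\<mu> \<in> P" "\<gamma> \<in> P"
      by (auto simp: covers_def root_order_def)
    then obtain z where z: "(\<mu>, z) \<in> ?S" "(z, \<gamma>) \<in> ?S\<^sup>*"
      by (meson converse_rtranclE)
    then have "z \<in> P" "z \<noteq> \<mu>" "(\<mu>, z) \<in> root_order P" "(z, \<gamma>) \<in> root_order P"
      using P' v by (auto simp: root_order_def simple_roots_def)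
    then have "z = \<gamma>" using c unfolding covers_def by blast
    then show "\<gamma> \<in> P \<and> \<mu> \<in> P \<and> \<gamma> - \<mu> \<in> simple_roots P"
      using z by auto
  }
  {
    assume a: "\<gamma> \<in> P \<and> \<mu> \<in> P \<and> \<gamma> - \<mu> \<in> simple_roots P"
    let ?\<alpha> = "\<gamma> - \<mu>"
    have "?\<alpha> \<in> P" using a by (auto simp: simple_roots_def)
    then have "v \<bullet> ?\<alpha> > 0" using v by blast
    then have ne: "?\<alpha> \<noteq> 0" by auto
    have no_between: False if z: "z \<in> P" "(\<mu>, z) \<in> root_order P" "(z, \<gamma>) \<in> root_order P" "z \<noteq> \<gamma>" "z \<noteq> \<mu>" for z
    proof -
      have s: "(\<mu>, z) \<in> ?S\<^sup>*" "(z, \<gamma>) \<in> ?S\<^sup>*" using z by (auto simp: root_order_def)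
      have lt: "v \<bullet> \<mu> < v \<bullet> z" "v \<bullet> z < v \<bullet> \<gamma>"
        using root_order_step_less[OF s(1) v] root_order_step_less[OF s(2) v] z by auto
      have "(z - \<mu>) \<bullet> ?\<alpha> \<le> 0"
        using root_order_inner[OF rs P _ s(1) v, of ?\<alpha>] a lt by (auto simp: inner_diff_right)
      moreover have "(\<gamma> - z) \<bullet> ?\<alpha> \<le> 0"
        using root_order_inner[OF rs P _ s(2) v, of ?\<alpha>] a lt by (auto simp: inner_diff_right)
      ultimately have "?\<alpha> \<bullet> ?\<alpha> \<le> 0"
        by (simp add: inner_diff_left)
      then show False using ne by (simp flip: not_less)
    qed
    moreover have "(\<mu>, \<gamma>) \<in> root_order P" using a by (auto simp: root_order_def)
    moreover have "\<mu> \<noteq> \<gamma>" using ne by simp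
    ultimately show "covers P (root_order P) \<gamma> \<mu>"
      unfolding covers_def using a no_between by (intro conjI notI) (simp_all, metis)
  }
qed

end

theory Submission
  imports Defs
begin

text \<open>
  Let \<open>\<gamma>\<close> be a root and let \<open>T\<close> be a set of simple roots \<open>\<alpha>\<close> with \<open>\<gamma> - \<alpha>\<close> a root. An analysis of the
  inner products in \<open>T \<union> {\<gamma>}\<close> shows that \<open>T\<close> has at most three elements, and that \<open>\<gamma>\<close> is not in the
  span of \<open>T\<close> if it has exactly three. Applied to \<open>\<gamma>\<close> and to \<open>- \<gamma>\<close> this bounds both degrees. The longest
  element of the parabolic subgroup of \<open>T\<close> permutes the positive roots outside the span of \<open>T\<close> and maps
  \<open>T\<close> to \<open>- T\<close>; hence \<open>\<gamma> - T\<close> consists of roots for as many positive roots \<open>\<gamma>\<close> outside the span of \<open>T\<close>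
  as \<open>\<gamma> + T\<close> does, and the coefficients of \<open>q\<^sup>3\<close> agree. The difference of the two polynomials is then a
  constant multiple of \<open>(q - 1)\<^sup>2\<close>, the constant being the number \<open>n\<close> of minimal elements (the simple
  roots) minus the number 1 of maximal elements (the highest root). In the simply-laced case each root is an
  eigenvector of the operator mapping \<open>x\<close> to the sum of all \<open>(\<gamma> \<bullet> x) *\<^sub>R \<gamma>\<close>, and its trace gives the
  number \<open>2 (|P| - n)\<close> of edges of the Hasse diagram.
\<close>

text \<open>The longest element of the parabolic subgroup of \<open>T\<close> controls positivity
  only outside the span of \<open>T\<close>, so the two counts can be compared only if the span
  contributes nothing. For three-element sets the inner products guarantee this, which is why their
  analysis has to give more than the bound 3. Roots may have several lengths, and a root and its
  double may both be present; the analysis therefore works with Cartan integers instead of a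
  classification. Unless \<open>\<gamma> = - \<beta>\<close>, at most one \<beta> in
  \<open>T\<close> forms a nonacute angle with \<gamma>. Without such a \<beta> the configuration
  behaves like a star-shaped Dynkin diagram. With it, \<beta> and \<gamma> have equal length and,
  together with \<gamma> - \<beta>, belong to a system of type B_2 or G_2, which leaves few
  positions for the other elements. The exceptional case \<open>\<gamma> = - \<beta>\<close>
  requires 2\<beta> to be a root.\<close>

text \<open>For \<open>obtuse_string\<close>: up to sign, \<open>g\<close> and \<open>b\<close> are
  the pairings of \<alpha> with the coroots of \<gamma> and \<beta>, and \<open>p\<close> and
  \<open>q\<close> those of \<gamma> and \<beta> with the coroot of \<alpha>. The bounds 4 are
  Cauchy-Schwarz, \<open>g * q = p * b\<close> reflects the equal length of \<beta> and \<gamma>,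
  and divisibility by 3 is integrality against the coroot of \<gamma> - \<beta>.\<close>

lemma small_cases_mod3:
  fixes g p b q l :: int
  assumes "g * p \<le> 4" "b * q \<le> 4" "g * q = p * b" "g + b = 3 * l" "g \<ge> 1" "p \<ge> 1" "b \<ge> 0" "q \<ge> 0"
  shows "(g, p, b, q) \<in> {(1, 1, 2, 2), (2, 2, 1, 1), (3, 1, 0, 0), (3, 1, 3, 1)}"
proof -
  have gb: "b \<le> 4" if "q \<ge> 1" using that assms(2,7) mult_left_mono[of 1 q b] by linarith
  have "g * 1 \<le> g * p" "1 * p \<le> g * p"
    using assms by (intro mult_left_mono mult_right_mono; simp)+
  then have "g \<le> 4" "p \<le> 4" using assms(1) by linarith+
  then have gp: "g = 1 \<or> g = 2 \<or> g = 3 \<or> g = 4" "p = 1 \<or> p = 2 \<or> p = 3 \<or> p = 4"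
    using assms(5,6) by linarith+
  have "b = 0 \<or> q \<ge> 1" using assms(3,6,8) by (cases "q = 0") auto
  then have b: "b = 0 \<or> b = 1 \<or> b = 2 \<or> b = 3 \<or> b = 4" using gb assms(7) by linarith
  show ?thesis
    using gp b assms(1-4) by (elim disjE; simp; presburger)
qed

text \<open>For \<open>right_string\<close>, with the same meaning of the integers. There \<beta>
  and \<gamma> are orthogonal: the two Cauchy-Schwarz bounds sharpen to a single Bessel bound, and
  \<gamma> - \<beta> has twice the squared length of \<gamma>, hence the divisor 2.\<close>

lemma small_cases_mod2:
  fixes g p b q l :: int
  assumes "g * p + b * q \<le> 4" "g * q = p * b" "g + b = 2 * l" "g \<ge> 1" "p \<ge> 1" "b \<ge> 0" "q \<ge> 0"
  shows "(g, p, b, q) \<in> {(1, 1, 1, 1), (1, 2, 1, 2), (2, 1, 0, 0), (2, 1, 2, 1), (2, 2, 0, 0), (4, 1, 0, 0)}"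
proof -
  have bq0: "b * q \<ge> 0" using assms by simp
  have gb: "b \<le> b * q" if "q \<ge> 1" using that assms(6) mult_left_mono[of 1 q b] by simp
  have "g * 1 \<le> g * p" "1 * p \<le> g * p"
    using assms by (intro mult_left_mono mult_right_mono; simp)+
  then have "g \<le> 4" "p \<le> 4" using assms(1) bq0 by linarith+
  then have gp: "g = 1 \<or> g = 2 \<or> g = 3 \<or> g = 4" "p = 1 \<or> p = 2 \<or> p = 3 \<or> p = 4"
    using assms(4,5) by linarith+
  have "b = 0 \<or> q \<ge> 1" using assms(2,5,7) by (cases "q = 0") auto
  moreover have "g * p \<ge> 1" using assms(4,5) by (simp add: int_one_le_iff_zero_less)
  ultimately have b: "b = 0 \<or> b = 1 \<or> b = 2 \<or> b = 3" using gb assms(1,6) by linarith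
  show ?thesis
    using gp b assms(1-3) by (elim disjE; simp; presburger)
qed

section \<open>Positive roots, simple roots and their independence\<close>

text \<open>Fixing the functional \<open>v\<close> hidden in \<open>positive_roots\<close> gives
  every root a real height, which drives the inductions and sign arguments.\<close>

locale based_root_system =
  fixes \<Delta> P :: "'a::euclidean_space set" and v :: 'a
  assumes rs: "root_system \<Delta>"
    and regular: "\<alpha> \<in> \<Delta> \<Longrightarrow> v \<bullet> \<alpha> \<noteq> 0"
    and P_eq: "P = {\<alpha> \<in> \<Delta>. v \<bullet> \<alpha> > 0}"
begin

abbreviation S :: "'a set" where "S \<equiv> simple_roots P"

definition reflection :: "'a \<Rightarrow> 'a \<Rightarrow> 'a" where
  "reflection \<alpha> x = x - (2 * (x \<bullet> \<alpha>) / (\<alpha> \<bullet> \<alpha>)) *\<^sub>R \<alpha>"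

lemma positive_roots: "positive_roots \<Delta> P"
  using regular P_eq unfolding positive_roots_def by blast

lemma finite_roots [simp]: "finite \<Delta>" and zero_notin [simp]: "0 \<notin> \<Delta>"
  and span_roots: "span \<Delta> = UNIV"
  and reflection_root: "\<alpha> \<in> \<Delta> \<Longrightarrow> \<beta> \<in> \<Delta> \<Longrightarrow> reflection \<alpha> \<beta> \<in> \<Delta>"
  and cartan_int: "\<alpha> \<in> \<Delta> \<Longrightarrow> \<beta> \<in> \<Delta> \<Longrightarrow> 2 * (\<beta> \<bullet> \<alpha>) / (\<alpha> \<bullet> \<alpha>) \<in> \<int>"
  using rs unfolding root_system_def reflection_def by auto

lemma root_norm_pos: "\<alpha> \<in> \<Delta> \<Longrightarrow> \<alpha> \<bullet> \<alpha> > 0"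
  using zero_notin by (metis inner_gt_zero_iff)

lemma cartan_obtain:
  assumes "\<alpha> \<in> \<Delta>" "\<beta> \<in> \<Delta>"
  obtains k :: int where "2 * (\<beta> \<bullet> \<alpha>) = of_int k * (\<alpha> \<bullet> \<alpha>)"
proof -
  obtain k :: int where "2 * (\<beta> \<bullet> \<alpha>) / (\<alpha> \<bullet> \<alpha>) = of_int k"
    using cartan_int[OF assms] by (metis Ints_cases)
  with root_norm_pos[OF assms(1)] have "2 * (\<beta> \<bullet> \<alpha>) = of_int k * (\<alpha> \<bullet> \<alpha>)"
    by (simp add: field_simps)
  then show thesis by (rule that)
qed

lemmas root_uminus = root_system_uminus[OF rs]
lemmas root_diff = root_system_diff[OF rs]
lemmas simple_nonpos = simple_roots_inner_nonpos[OF rs positive_roots]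

lemma root_uminus_iff: "- \<alpha> \<in> \<Delta> \<longleftrightarrow> \<alpha> \<in> \<Delta>"
  using root_uminus[of \<alpha>] root_uminus[of "- \<alpha>"] by auto

lemma root_diff_commute: "\<alpha> - \<beta> \<in> \<Delta> \<longleftrightarrow> \<beta> - \<alpha> \<in> \<Delta>"
  using root_uminus_iff[of "\<alpha> - \<beta>"] by simp

lemma root_add:
  assumes "\<alpha> \<in> \<Delta>" "\<beta> \<in> \<Delta>" "\<alpha> \<bullet> \<beta> < 0" "\<alpha> \<noteq> - \<beta>"
  shows "\<alpha> + \<beta> \<in> \<Delta>"
  using root_diff[of \<alpha> "- \<beta>"] assms root_uminus by auto

lemma pos_root: "\<gamma> \<in> P \<Longrightarrow> \<gamma> \<in> \<Delta>" and pos_inner: "\<gamma> \<in> P \<Longrightarrow> v \<bullet> \<gamma> > 0"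
  and finite_pos [simp]: "finite P"
  using P_eq by auto

lemma posI: "\<gamma> \<in> \<Delta> \<Longrightarrow> v \<bullet> \<gamma> > 0 \<Longrightarrow> \<gamma> \<in> P"
  using P_eq by auto

lemma pos_cases: "\<gamma> \<in> \<Delta> \<Longrightarrow> (\<gamma> \<in> P \<Longrightarrow> R) \<Longrightarrow> (- \<gamma> \<in> P \<Longrightarrow> R) \<Longrightarrow> R"
  using regular[of \<gamma>] root_uminus[of \<gamma>] posI[of \<gamma>] posI[of "- \<gamma>"] by force

lemma pos_not_neg: "\<gamma> \<in> P \<Longrightarrow> - \<gamma> \<notin> P"
  using pos_inner[of \<gamma>] pos_inner[of "- \<gamma>"] by auto

lemma simple_pos: "\<alpha> \<in> S \<Longrightarrow> \<alpha> \<in> P" and simple_root: "\<alpha> \<in> S \<Longrightarrow> \<alpha> \<in> \<Delta>"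
  and simple_indecomposable: "\<alpha> \<in> S \<Longrightarrow> \<beta> \<in> P \<Longrightarrow> \<gamma> \<in> P \<Longrightarrow> \<alpha> \<noteq> \<beta> + \<gamma>"
  using pos_root by (auto simp: simple_roots_def)

lemma finite_simple [simp]: "finite S"
  using finite_subset[of S P] simple_pos by auto

lemma pos_add: "\<beta> \<in> P \<Longrightarrow> \<gamma> \<in> P \<Longrightarrow> \<beta> + \<gamma> \<in> \<Delta> \<Longrightarrow> \<beta> + \<gamma> \<in> P"
  using pos_inner by (intro posI) (auto simp: inner_add_right add_pos_pos)

lemma pos_diff_simple:
  assumes "\<gamma> \<in> P" "\<alpha> \<in> S" "\<gamma> - \<alpha> \<in> \<Delta>"
  shows "\<gamma> - \<alpha> \<in> P"
  using assms(3)
proof (rule pos_cases)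
  assume "- (\<gamma> - \<alpha>) \<in> P"
  then show ?thesis
    using simple_indecomposable[OF assms(2,1)] by fastforce
qed

lemma simple_diff_not_root:
  assumes "\<alpha> \<in> S" "\<beta> \<in> S"
  shows "\<alpha> - \<beta> \<notin> \<Delta>"
proof
  assume "\<alpha> - \<beta> \<in> \<Delta>"
  then have "\<alpha> - \<beta> \<in> P"
    using assms simple_pos by (intro pos_diff_simple) auto
  then show False
    using simple_indecomposable[OF assms(1), of "\<alpha> - \<beta>" \<beta>] assms simple_pos by auto
qed

lemma pos_induct [consumes 1, case_names simple add]:
  assumes "\<gamma> \<in> P"
    and simple: "\<And>\<alpha>. \<alpha> \<in> S \<Longrightarrow> Q \<alpha>"
    and add: "\<And>\<beta> \<gamma>. \<beta> \<in> P \<Longrightarrow> \<gamma> \<in> P \<Longrightarrow> \<beta> + \<gamma> \<in> P \<Longrightarrow> Q \<beta> \<Longrightarrow> Q \<gamma> \<Longrightarrow> Q (\<beta> + \<gamma>)"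
  shows "Q \<gamma>"
  using assms(1)
proof (induction "card {\<delta> \<in> P. v \<bullet> \<delta> < v \<bullet> \<gamma>}" arbitrary: \<gamma> rule: less_induct)
  case less
  \<comment> \<open>The values of \<open>v\<close> are real, so progress is measured by the number
    of positive roots of smaller value.\<close>
  have smaller: "card {\<delta> \<in> P. v \<bullet> \<delta> < v \<bullet> \<beta>} < card {\<delta> \<in> P. v \<bullet> \<delta> < v \<bullet> \<gamma>}"
    if "\<beta> \<in> P" "v \<bullet> \<beta> < v \<bullet> \<gamma>" for \<beta>
    using that by (intro psubset_card_mono) auto
  show ?case
  proof (cases "\<gamma> \<in> S")
    case True
    then show ?thesis by (rule simple)
  next
    case False
    then obtain \<beta> \<delta> where *: "\<beta> \<in> P" "\<delta> \<in> P" "\<gamma> = \<beta> + \<delta>"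
      using less.prems by (auto simp: simple_roots_def)
    then have "v \<bullet> \<beta> < v \<bullet> \<gamma>" "v \<bullet> \<delta> < v \<bullet> \<gamma>"
      using pos_inner by (auto simp: inner_add_right)
    then have "Q \<beta>" "Q \<delta>"
      using * smaller less.hyps by blast+
    then show ?thesis
      using add[OF *(1,2)] less.prems *(3) by blast
  qed
qed

lemma pos_combination:
  assumes "\<gamma> \<in> P"
  shows "\<exists>k :: 'a \<Rightarrow> nat. \<gamma> = (\<Sum>\<alpha>\<in>S. real (k \<alpha>) *\<^sub>R \<alpha>)"
  using assms
proof (induction rule: pos_induct)
  case (simple \<alpha>)
  then have "\<alpha> = (\<Sum>\<beta>\<in>S. real (if \<beta> = \<alpha> then 1 else 0) *\<^sub>R \<beta>)"
    by (simp add: if_distrib[of real] if_distrib[of "\<lambda>x. x *\<^sub>R _"] sum.delta cong: if_cong)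
  then show ?case by (rule exI[of _ "\<lambda>\<beta>. if \<beta> = \<alpha> then 1 else 0"])
next
  case (add \<beta> \<gamma>)
  then obtain k l :: "'a \<Rightarrow> nat" where kl: "\<beta> = (\<Sum>\<alpha>\<in>S. real (k \<alpha>) *\<^sub>R \<alpha>)" "\<gamma> = (\<Sum>\<alpha>\<in>S. real (l \<alpha>) *\<^sub>R \<alpha>)"
    by blast
  have "\<beta> + \<gamma> = (\<Sum>\<alpha>\<in>S. real (k \<alpha> + l \<alpha>) *\<^sub>R \<alpha>)"
    by (subst kl(1), subst kl(2)) (simp add: sum.distrib scaleR_left_distrib)
  then show ?case by (rule exI[of _ "\<lambda>\<alpha>. k \<alpha> + l \<alpha>"])
qed

text \<open>Vectors in an open half-space at pairwise nonacute angles are independent: a relation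
  splits into \<open>p = m\<close> with nonnegative coefficients on disjoint supports, so
  \<open>p \<bullet> m \<le> 0\<close> forces \<open>p = 0\<close>, and pairing with
  \<open>v\<close> kills each coefficient.\<close>

lemma independent_simple: "independent S"
proof (rule independent_if_scalars_zero[OF finite_simple])
  fix f \<alpha>
  assume sum0: "(\<Sum>\<alpha>\<in>S. f \<alpha> *\<^sub>R \<alpha>) = 0" and "\<alpha> \<in> S"
  define p where "p = (\<Sum>\<alpha>\<in>S. max (f \<alpha>) 0 *\<^sub>R \<alpha>)"
  define m where "m = (\<Sum>\<alpha>\<in>S. max (- f \<alpha>) 0 *\<^sub>R \<alpha>)"
  have "p - m = (\<Sum>\<alpha>\<in>S. f \<alpha> *\<^sub>R \<alpha>)"
    unfolding p_def m_def sum_subtractf[symmetric]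
    by (intro sum.cong) (auto simp: max_def scaleR_left_diff_distrib[symmetric])
  then have pm: "p = m" using sum0 by simp
  have "p \<bullet> m \<le> 0"
    unfolding p_def m_def inner_sum_left inner_sum_right
  proof (intro sum_nonpos)
    fix \<alpha> \<beta> assume "\<alpha> \<in> S" "\<beta> \<in> S"
    then show "max (f \<alpha>) 0 *\<^sub>R \<alpha> \<bullet> max (- f \<beta>) 0 *\<^sub>R \<beta> \<le> 0"
      using simple_nonpos[of \<alpha> \<beta>] by (cases "\<alpha> = \<beta>") (auto simp: max_def mult_le_0_iff)
  qed
  then have "p = 0" using pm by (metis inner_eq_zero_iff inner_ge_zero order_antisym)
  then have "m = 0" using pm by simp
  have nonneg: "c \<alpha> = 0" if "(\<Sum>\<alpha>\<in>S. c \<alpha> *\<^sub>R \<alpha>) = 0" "\<And>\<alpha>. c \<alpha> \<ge> 0" for c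
  proof -
    have "(\<Sum>\<alpha>\<in>S. c \<alpha> * (v \<bullet> \<alpha>)) = v \<bullet> (\<Sum>\<alpha>\<in>S. c \<alpha> *\<^sub>R \<alpha>)"
      by (simp add: inner_sum_right)
    then have "(\<Sum>\<alpha>\<in>S. c \<alpha> * (v \<bullet> \<alpha>)) = 0"
      using that(1) by simp
    moreover have "\<And>\<alpha>. \<alpha> \<in> S \<Longrightarrow> c \<alpha> * (v \<bullet> \<alpha>) \<ge> 0"
      using that(2) pos_inner simple_pos by (simp add: less_imp_le)
    ultimately have "c \<alpha> * (v \<bullet> \<alpha>) = 0"
      using \<open>\<alpha> \<in> S\<close> sum_nonneg_eq_0_iff[OF finite_simple, of "\<lambda>\<alpha>. c \<alpha> * (v \<bullet> \<alpha>)"] by simp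
    then show ?thesis using pos_inner[OF simple_pos[OF \<open>\<alpha> \<in> S\<close>]] by simp
  qed
  have "max (f \<alpha>) 0 = 0" "max (- f \<alpha>) 0 = 0"
    using nonneg[of "\<lambda>\<alpha>. max (f \<alpha>) 0"] nonneg[of "\<lambda>\<alpha>. max (- f \<alpha>) 0"] \<open>p = 0\<close> \<open>m = 0\<close>
    unfolding p_def m_def by auto
  then show "f \<alpha> = 0" by (auto simp: max_def split: if_splits)
qed

lemma root_in_span_simple: "\<gamma> \<in> \<Delta> \<Longrightarrow> \<gamma> \<in> span S"
proof -
  have "\<gamma> \<in> span S" if "\<gamma> \<in> P" for \<gamma>
    using that by (induction rule: pos_induct) (auto intro: span_base span_add)
  then show "\<gamma> \<in> \<Delta> \<Longrightarrow> \<gamma> \<in> span S"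
    by (metis pos_cases span_neg minus_minus)
qed

lemma span_simple: "span S = UNIV"
  using root_in_span_simple span_roots span_minimal[of \<Delta> "span S"] by auto

lemma card_simple: "card S = DIM('a)"
  using independent_simple span_simple dim_eq_card[of S UNIV] by simp

text \<open>Coordinates of \<gamma> are nonnegative, so nonacute angles with all of \<open>S\<close>
  would give \<open>\<gamma> \<bullet> \<gamma> \<le> 0\<close>. With \<open>root_diff\<close>,
  every positive root that is not simple can thus step down by a simple root.\<close>

lemma pos_acute_simple:
  assumes "\<gamma> \<in> P"
  obtains \<alpha> where "\<alpha> \<in> S" "\<gamma> \<bullet> \<alpha> > 0"
proof (rule ccontr)
  assume "\<not> thesis"
  then have np: "\<And>\<alpha>. \<alpha> \<in> S \<Longrightarrow> \<gamma> \<bullet> \<alpha> \<le> 0" using that by force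
  obtain k :: "'a \<Rightarrow> nat" where k: "\<gamma> = (\<Sum>\<alpha>\<in>S. real (k \<alpha>) *\<^sub>R \<alpha>)"
    using pos_combination[OF assms] by blast
  have "\<gamma> \<bullet> \<gamma> = (\<Sum>\<alpha>\<in>S. real (k \<alpha>) * (\<gamma> \<bullet> \<alpha>))"
    by (subst (2) k) (simp add: inner_sum_right)
  also have "\<dots> \<le> 0" using np by (intro sum_nonpos) (simp add: mult_nonneg_nonpos)
  finally show False using root_norm_pos[OF pos_root[OF assms]] by simp
qed

subsection \<open>Simple roots that can be subtracted from a root\<close>

text \<open>If \<gamma> were shorter than \<beta>, the pairing of \<beta> with the coroot of
  \<gamma> + \<beta> would lie strictly between 1 and 2.\<close>

lemma acute_sum_norm:
  assumes "\<gamma> \<in> \<Delta>" "\<beta> \<in> \<Delta>" "\<gamma> + \<beta> \<in> \<Delta>" "\<gamma> \<bullet> \<beta> \<ge> 0"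
  shows "\<gamma> \<bullet> \<gamma> = \<beta> \<bullet> \<beta>"
proof -
  have "\<not> \<gamma> \<bullet> \<gamma> < \<beta> \<bullet> \<beta>" if r: "\<gamma> \<in> \<Delta>" "\<beta> \<in> \<Delta>" "\<gamma> + \<beta> \<in> \<Delta>" "\<gamma> \<bullet> \<beta> \<ge> 0" for \<gamma> \<beta>
  proof
    assume less: "\<gamma> \<bullet> \<gamma> < \<beta> \<bullet> \<beta>"
    define X where "X = (\<gamma> + \<beta>) \<bullet> (\<gamma> + \<beta>)"
    have X: "X = \<gamma> \<bullet> \<gamma> + 2 * (\<gamma> \<bullet> \<beta>) + \<beta> \<bullet> \<beta>"
      unfolding X_def by (simp add: inner_add inner_commute)
    obtain k :: int where "2 * (\<beta> \<bullet> (\<gamma> + \<beta>)) = of_int k * X"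
      using cartan_obtain[OF r(3,2)] unfolding X_def by blast
    then have k: "2 * (\<gamma> \<bullet> \<beta>) + 2 * (\<beta> \<bullet> \<beta>) = of_int k * X"
      by (simp add: inner_add inner_commute)
    have "X > 0" using root_norm_pos[OF r(3)] unfolding X_def .
    have "1 * X < of_int k * X" "of_int k * X < 2 * X"
      using k X less r(4) root_norm_pos[OF r(1)] by linarith+
    then have "1 < real_of_int k" "real_of_int k < 2"
      using \<open>X > 0\<close> by (auto simp only: mult_less_cancel_right_pos)
    then have "1 < k" "k < 2" by simp_all
    then show False by simp
  qed
  from this[of \<gamma> \<beta>] this[of \<beta> \<gamma>] show ?thesis
    using assms by (simp add: inner_commute add.commute)
qed

text \<open>One of \<alpha> and -\<alpha> makes a nonobtuse angle with \<gamma>, and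
  \<open>acute_sum_norm\<close> applies to it.\<close>

lemma string_norm:
  assumes "\<gamma> \<in> \<Delta>" "\<alpha> \<in> \<Delta>" "\<gamma> + \<alpha> \<in> \<Delta>" "\<gamma> - \<alpha> \<in> \<Delta>"
  shows "\<alpha> \<bullet> \<alpha> = \<gamma> \<bullet> \<gamma>"
  using acute_sum_norm[of \<gamma> \<alpha>] acute_sum_norm[of \<gamma> "- \<alpha>"] assms root_uminus[of \<alpha>]
  by (cases "\<gamma> \<bullet> \<alpha> \<ge> 0") auto

lemma simple_sum_nonzero:
  assumes "\<alpha> \<in> S" "\<beta> \<in> S"
  shows "\<alpha> + \<beta> \<noteq> 0"
proof
  assume "\<alpha> + \<beta> = 0"
  then have "v \<bullet> (\<alpha> + \<beta>) = 0" by simp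
  then show False
    using pos_inner[OF simple_pos[OF assms(1)]] pos_inner[OF simple_pos[OF assms(2)]]
    by (simp add: inner_add_right)
qed

text \<open>Both roots have the length of \<gamma>. As \<alpha> - \<beta> is not a root, neither
  \<gamma> + \<alpha>, \<gamma> + \<beta> nor \<gamma> - \<beta>, \<gamma> - \<alpha> form an acute
  angle; but these two inner products add up to
  \<open>(\<alpha> + \<beta>) \<bullet> (\<alpha> + \<beta>)\<close>.\<close>

lemma simple_string_unique:
  assumes \<gamma>: "\<gamma> \<in> \<Delta>" and S: "\<alpha> \<in> S" "\<beta> \<in> S"
    and \<alpha>: "\<gamma> + \<alpha> \<in> \<Delta>" "\<gamma> - \<alpha> \<in> \<Delta>" and \<beta>: "\<gamma> + \<beta> \<in> \<Delta>" "\<gamma> - \<beta> \<in> \<Delta>"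
  shows "\<alpha> = \<beta>"
proof (rule ccontr)
  assume ne: "\<alpha> \<noteq> \<beta>"
  have nd: "\<alpha> - \<beta> \<notin> \<Delta>" using simple_diff_not_root[OF S] .
  have n: "\<alpha> \<bullet> \<alpha> = \<gamma> \<bullet> \<gamma>" "\<beta> \<bullet> \<beta> = \<gamma> \<bullet> \<gamma>"
    using string_norm[OF \<gamma> simple_root] S \<alpha> \<beta> by auto
  have "(\<gamma> + \<alpha>) \<bullet> (\<gamma> + \<beta>) \<le> 0"
    using root_diff[OF \<alpha>(1) \<beta>(1)] ne nd by (force simp: not_less)
  moreover have "(\<gamma> - \<beta>) \<bullet> (\<gamma> - \<alpha>) \<le> 0"
    using root_diff[OF \<beta>(2) \<alpha>(2)] ne nd by (force simp: not_less)
  ultimately have "(\<alpha> + \<beta>) \<bullet> (\<alpha> + \<beta>) \<le> 0"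
    using n by (simp add: inner_add inner_diff inner_commute)
  then have "\<alpha> + \<beta> = 0" by (simp flip: not_less)
  then show False using simple_sum_nonzero[OF S] by blast
qed

section \<open>Spans of sets of simple roots\<close>

lemma span_simple_coeff:
  assumes "T \<subseteq> S" and c: "(\<Sum>\<alpha>\<in>S. c \<alpha> *\<^sub>R \<alpha>) \<in> span T" and "\<alpha> \<in> S - T"
  shows "c \<alpha> = 0"
proof -
  have fin: "finite T" using assms(1) finite_subset finite_simple by blast
  obtain u where "(\<Sum>\<alpha>\<in>S. c \<alpha> *\<^sub>R \<alpha>) = (\<Sum>\<alpha>\<in>T. u \<alpha> *\<^sub>R \<alpha>)"
    using c span_finite[OF fin] by auto
  then have u: "(\<Sum>\<alpha>\<in>S. c \<alpha> *\<^sub>R \<alpha>) = (\<Sum>\<alpha>\<in>S. (if \<alpha> \<in> T then u \<alpha> else 0) *\<^sub>R \<alpha>)"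
    using assms(1) by (simp add: if_distrib[of "\<lambda>x. x *\<^sub>R _"] sum.If_cases Int_absorb1 cong: if_cong)
  have "(\<Sum>\<alpha>\<in>S. (c \<alpha> - (if \<alpha> \<in> T then u \<alpha> else 0)) *\<^sub>R \<alpha>) = 0"
    unfolding scaleR_left_diff_distrib sum_subtractf using u by simp
  then have "c \<alpha> - (if \<alpha> \<in> T then u \<alpha> else 0) = 0"
    using independentD[OF independent_simple finite_simple subset_refl, of "\<lambda>\<alpha>. c \<alpha> - (if \<alpha> \<in> T then u \<alpha> else 0)"]
      assms(3) by simp
  then show ?thesis using assms(3) by simp
qed

lemma pos_span_combination:
  assumes "\<gamma> \<in> P" "\<gamma> \<in> span T" "T \<subseteq> S"
  shows "\<exists>k :: 'a \<Rightarrow> nat. \<gamma> = (\<Sum>\<alpha>\<in>T. real (k \<alpha>) *\<^sub>R \<alpha>)"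
proof -
  obtain k :: "'a \<Rightarrow> nat" where k: "\<gamma> = (\<Sum>\<alpha>\<in>S. real (k \<alpha>) *\<^sub>R \<alpha>)"
    using pos_combination[OF assms(1)] by blast
  have "real (k \<alpha>) = 0" if "\<alpha> \<in> S - T" for \<alpha>
    using span_simple_coeff[OF assms(3) _ that, of "\<lambda>\<alpha>. real (k \<alpha>)"] assms(2)
    by (simp flip: k)
  then have "\<gamma> = (\<Sum>\<alpha>\<in>T. real (k \<alpha>) *\<^sub>R \<alpha>)"
    using assms(3) by (subst k, intro sum.mono_neutral_right) auto
  then show ?thesis by (rule exI[of _ k])
qed

text \<open>Coordinates of positive roots are nonnegative, so nothing cancels outside
  \<open>T\<close>.\<close>

lemma pos_summand_in_span:
  assumes "\<beta> \<in> P" "\<gamma> \<in> P" "\<beta> + \<gamma> \<in> span T" "T \<subseteq> S"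
  shows "\<beta> \<in> span T"
proof -
  obtain k l :: "'a \<Rightarrow> nat"
    where k: "\<beta> = (\<Sum>\<alpha>\<in>S. real (k \<alpha>) *\<^sub>R \<alpha>)" and l: "\<gamma> = (\<Sum>\<alpha>\<in>S. real (l \<alpha>) *\<^sub>R \<alpha>)"
    using pos_combination assms(1,2) by metis
  have "\<beta> + \<gamma> = (\<Sum>\<alpha>\<in>S. real (k \<alpha> + l \<alpha>) *\<^sub>R \<alpha>)"
    by (subst k, subst l) (simp add: sum.distrib scaleR_left_distrib)
  then have "real (k \<alpha> + l \<alpha>) = 0" if "\<alpha> \<in> S - T" for \<alpha>
    using span_simple_coeff[OF assms(4) _ that, of "\<lambda>\<alpha>. real (k \<alpha> + l \<alpha>)"] assms(3) by simp
  then have "k \<alpha> = 0" if "\<alpha> \<in> S - T" for \<alpha> using that by fastforce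
  then have "\<beta> = (\<Sum>\<alpha>\<in>T. real (k \<alpha>) *\<^sub>R \<alpha>)"
    using assms(4) by (subst k, intro sum.mono_neutral_right) auto
  then show ?thesis by (auto intro: span_sum span_mul span_base)
qed

text \<open>
  Pairing \<open>\<gamma> = (\<Sum>\<alpha>\<in>T. k \<alpha> *\<^sub>R \<alpha>)\<close> with the coroot of \<open>\<gamma>\<close> writes 2 as a sum of at least three
  positive integers.
\<close>

lemma acute_simple_not_in_span:
  assumes \<gamma>: "\<gamma> \<in> \<Delta>" and T: "T \<subseteq> S" "card T \<ge> 3" and acute: "\<And>\<alpha>. \<alpha> \<in> T \<Longrightarrow> \<gamma> \<bullet> \<alpha> > 0"
  shows "\<gamma> \<notin> span T"
proof
  assume span: "\<gamma> \<in> span T"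
  have "\<gamma> \<in> P" using \<gamma>
  proof (rule pos_cases)
    assume "- \<gamma> \<in> P"
    then obtain k :: "'a \<Rightarrow> nat" where k: "- \<gamma> = (\<Sum>\<alpha>\<in>T. real (k \<alpha>) *\<^sub>R \<alpha>)"
      using pos_span_combination[of "- \<gamma>" T] span T by (auto simp: span_neg)
    have "\<gamma> \<bullet> (- \<gamma>) = (\<Sum>\<alpha>\<in>T. real (k \<alpha>) * (\<gamma> \<bullet> \<alpha>))"
      unfolding k by (simp add: inner_sum_right)
    also have "\<dots> \<ge> 0" using acute by (intro sum_nonneg) (simp add: less_imp_le)
    finally show ?thesis using root_norm_pos[OF \<gamma>] by simp
  qed
  then obtain k :: "'a \<Rightarrow> nat" where k: "\<gamma> = (\<Sum>\<alpha>\<in>T. real (k \<alpha>) *\<^sub>R \<alpha>)"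
    using pos_span_combination span T by blast
  \<comment> \<open>With coefficient 0 at \<alpha>, \<open>\<alpha> \<bullet> \<gamma>\<close> would
    be a sum of nonpositive terms.\<close>
  have kpos: "real (k \<alpha>) \<ge> 1" if "\<alpha> \<in> T" for \<alpha>
  proof (rule ccontr)
    assume "\<not> ?thesis"
    then have k0: "k \<alpha> = 0" by simp
    have "\<alpha> \<bullet> \<gamma> = (\<Sum>\<beta>\<in>T. real (k \<beta>) * (\<alpha> \<bullet> \<beta>))"
      by (subst k) (simp add: inner_sum_right)
    also have "\<dots> \<le> 0"
    proof (intro sum_nonpos)
      fix \<beta> assume "\<beta> \<in> T"
      then show "real (k \<beta>) * (\<alpha> \<bullet> \<beta>) \<le> 0"
        using simple_nonpos[of \<alpha> \<beta>] k0 T that by (cases "\<alpha> = \<beta>") (auto simp: mult_le_0_iff dest: subsetD)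
    qed
    finally show False using acute[OF that] by (simp add: inner_commute)
  qed
  have half: "\<gamma> \<bullet> \<alpha> \<ge> \<gamma> \<bullet> \<gamma> / 2" if "\<alpha> \<in> T" for \<alpha>
  proof -
    have "\<alpha> \<in> \<Delta>" using that T simple_root by blast
    then obtain m :: int where m: "2 * (\<alpha> \<bullet> \<gamma>) = of_int m * (\<gamma> \<bullet> \<gamma>)"
      using cartan_obtain[OF \<gamma>] by blast
    then have "real_of_int m * (\<gamma> \<bullet> \<gamma>) > 0" using acute[OF that] by (simp add: inner_commute)
    then have "m \<ge> 1" using root_norm_pos[OF \<gamma>] by (simp add: zero_less_mult_iff)
    then have "1 * (\<gamma> \<bullet> \<gamma>) \<le> real_of_int m * (\<gamma> \<bullet> \<gamma>)"
      using root_norm_pos[OF \<gamma>] by (intro mult_right_mono) auto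
    then show ?thesis using m by (simp add: inner_commute)
  qed
  have "3 * (\<gamma> \<bullet> \<gamma> / 2) \<le> real (card T) * (\<gamma> \<bullet> \<gamma> / 2)"
    using T(2) by (intro mult_right_mono) auto
  also have "\<dots> = (\<Sum>\<alpha>\<in>T. 1 * (\<gamma> \<bullet> \<gamma> / 2))" by simp
  also have "\<dots> \<le> (\<Sum>\<alpha>\<in>T. real (k \<alpha>) * (\<gamma> \<bullet> \<alpha>))"
    using kpos half by (intro sum_mono mult_mono) auto
  also have "\<dots> = \<gamma> \<bullet> \<gamma>" by (subst (3) k) (simp add: inner_sum_right)
  finally show False using root_norm_pos[OF \<gamma>] by simp
qed

text \<open>
  Four such simple roots would form with \<open>- \<gamma>\<close> a Dynkin diagram with a node of valency four; for the
  weights \<open>t\<close> below \<open>\<gamma> - (\<Sum>\<alpha>\<in>U. t \<alpha> *\<^sub>R \<alpha>)\<close> would be isotropic.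
\<close>

lemma acute_simple_card_le_3:
  assumes \<gamma>: "\<gamma> \<in> \<Delta>" and T: "T \<subseteq> S" and acute: "\<And>\<alpha>. \<alpha> \<in> T \<Longrightarrow> \<gamma> \<bullet> \<alpha> > 0"
  shows "card T \<le> 3"
proof (rule ccontr)
  assume "\<not> ?thesis"
  then obtain U where U: "U \<subseteq> T" "card U = 4" "finite U"
    using obtain_subset_with_card_n[of 4 T] by auto
  \<comment> \<open>The rescaled roots have half the length of \<gamma>. For equal lengths and
    angles of 60 degrees, \<open>\<gamma> - s\<close> is up to sign half the null vector of the
    affine diagram of D_4, which has weight 2 at the centre -\<gamma> and 1 at the four
    ends.\<close>
  define t where "t = (\<lambda>\<alpha>::'a. norm \<gamma> / (2 * norm \<alpha>))"
  have root: "\<alpha> \<in> \<Delta>" "norm \<alpha> > 0" if "\<alpha> \<in> U" for \<alpha>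
    using that U T simple_root root_norm_pos by fastforce+
  \<comment> \<open>Both Cartan integers of \<gamma> and \<alpha> are at least 1, so the cosine of
    their angle is at least 1/2.\<close>
  have cos: "t \<alpha> * (\<gamma> \<bullet> \<alpha>) \<ge> \<gamma> \<bullet> \<gamma> / 4" if \<alpha>: "\<alpha> \<in> U" for \<alpha>
  proof -
    obtain m l :: int where m: "2 * (\<alpha> \<bullet> \<gamma>) = of_int m * (\<gamma> \<bullet> \<gamma>)" and l: "2 * (\<gamma> \<bullet> \<alpha>) = of_int l * (\<alpha> \<bullet> \<alpha>)"
      using cartan_obtain[OF \<gamma> root(1)[OF \<alpha>]] cartan_obtain[OF root(1)[OF \<alpha>] \<gamma>] by metis
    have pos: "\<gamma> \<bullet> \<alpha> > 0" using acute \<alpha> U by blast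
    have "real_of_int m * (\<gamma> \<bullet> \<gamma>) > 0" "real_of_int l * (\<alpha> \<bullet> \<alpha>) > 0"
      using m l pos by (auto simp: inner_commute)
    then have "m \<ge> 1" "l \<ge> 1"
      using root_norm_pos[OF \<gamma>] root_norm_pos[OF root(1)[OF \<alpha>]] by (auto simp: zero_less_mult_iff)
    then have "1 * (\<gamma> \<bullet> \<gamma>) \<le> real_of_int m * (\<gamma> \<bullet> \<gamma>)" "1 * (\<alpha> \<bullet> \<alpha>) \<le> real_of_int l * (\<alpha> \<bullet> \<alpha>)"
      by (intro mult_right_mono; simp)+
    then have "\<gamma> \<bullet> \<gamma> \<le> 2 * (\<gamma> \<bullet> \<alpha>)" "\<alpha> \<bullet> \<alpha> \<le> 2 * (\<gamma> \<bullet> \<alpha>)"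
      using m l by (simp_all add: inner_commute)
    then have "(\<gamma> \<bullet> \<gamma>) * (\<alpha> \<bullet> \<alpha>) \<le> (2 * (\<gamma> \<bullet> \<alpha>)) * (2 * (\<gamma> \<bullet> \<alpha>))"
      using pos by (intro mult_mono) auto
    then have "(norm \<gamma> * norm \<alpha>)\<^sup>2 \<le> (2 * (\<gamma> \<bullet> \<alpha>))\<^sup>2"
      unfolding power_mult_distrib power2_norm_eq_inner by (simp add: power2_eq_square)
    then have "norm \<gamma> * norm \<alpha> \<le> 2 * (\<gamma> \<bullet> \<alpha>)"
      by (rule power2_le_imp_le) (use pos in simp)
    then have "norm \<gamma> * (norm \<gamma> * norm \<alpha>) \<le> norm \<gamma> * (2 * (\<gamma> \<bullet> \<alpha>))"
      by (intro mult_left_mono) auto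
    moreover have "\<gamma> \<bullet> \<gamma> = norm \<gamma> * norm \<gamma>"
      by (simp add: power2_norm_eq_inner[symmetric] power2_eq_square)
    ultimately show ?thesis
      using root(2)[OF \<alpha>] unfolding t_def by (simp add: field_simps)
  qed
  define s where "s = (\<Sum>\<alpha>\<in>U. t \<alpha> *\<^sub>R \<alpha>)"
  have "\<gamma> \<bullet> s = (\<Sum>\<alpha>\<in>U. t \<alpha> * (\<gamma> \<bullet> \<alpha>))"
    unfolding s_def by (simp add: inner_sum_right)
  also have "\<dots> \<ge> (\<Sum>\<alpha>\<in>U. \<gamma> \<bullet> \<gamma> / 4)" using cos by (intro sum_mono) auto
  finally have gs: "\<gamma> \<bullet> s \<ge> \<gamma> \<bullet> \<gamma>" using U by simp
  have "s \<bullet> s = (\<Sum>\<alpha>\<in>U. \<Sum>\<beta>\<in>U. t \<alpha> * t \<beta> * (\<alpha> \<bullet> \<beta>))"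
    unfolding s_def inner_sum_left inner_sum_right
    by (intro sum.cong refl) (simp add: inner_commute[of _ "_ :: 'a"] mult_ac)
  also have "\<dots> \<le> (\<Sum>\<alpha>\<in>U. \<Sum>\<beta>\<in>U. if \<beta> = \<alpha> then \<gamma> \<bullet> \<gamma> / 4 else 0)"
  proof (intro sum_mono)
    fix \<alpha> \<beta> assume ab: "\<alpha> \<in> U" "\<beta> \<in> U"
    have "t \<alpha> * t \<alpha> * (\<alpha> \<bullet> \<alpha>) = \<gamma> \<bullet> \<gamma> / 4"
      using root(2)[OF ab(1)] unfolding t_def power2_norm_eq_inner[symmetric] power2_eq_square
      by simp
    moreover have "t \<alpha> * t \<beta> * (\<alpha> \<bullet> \<beta>) \<le> 0" if "\<alpha> \<noteq> \<beta>"
    proof (rule mult_nonneg_nonpos)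
      show "0 \<le> t \<alpha> * t \<beta>" unfolding t_def by simp
      show "\<alpha> \<bullet> \<beta> \<le> 0" using ab U(1) T that by (intro simple_nonpos) blast+
    qed
    ultimately show "t \<alpha> * t \<beta> * (\<alpha> \<bullet> \<beta>) \<le> (if \<beta> = \<alpha> then \<gamma> \<bullet> \<gamma> / 4 else 0)"
      by auto
  qed
  also have "\<dots> = \<gamma> \<bullet> \<gamma>" using U by simp
  finally have "(\<gamma> - s) \<bullet> (\<gamma> - s) \<le> 0"
    using gs by (simp add: inner_diff inner_commute)
  then have "\<gamma> = s" by (simp flip: not_less)
  then have "\<gamma> \<in> span U" unfolding s_def by (auto intro: span_sum span_mul span_base)
  then show False
    using acute_simple_not_in_span[OF \<gamma>, of U] U T acute by (auto dest: subsetD)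
qed

section \<open>Simple roots at a nonacute angle to \<gamma>\<close>

text \<open>Signs are chosen so that all four integers are nonnegative. Since \<beta> and \<gamma>
  have equal length, \<open>b\<close> can be measured against
  \<open>\<gamma> \<bullet> \<gamma>\<close>; the last equation then compares two expressions for
  the product of \<open>2 * (\<gamma> \<bullet> \<alpha>)\<close> and
  \<open>2 * (\<beta> \<bullet> \<alpha>)\<close>.\<close>

lemma cartan_pair_obtain:
  assumes \<gamma>: "\<gamma> \<in> \<Delta>" and \<beta>: "\<beta> \<in> S" and norm: "\<beta> \<bullet> \<beta> = \<gamma> \<bullet> \<gamma>" and "\<gamma> \<bullet> \<beta> \<le> 0"
    and \<alpha>: "\<alpha> \<in> S" "\<gamma> \<bullet> \<alpha> > 0"
  obtains g p b q :: int
  where "2 * (\<gamma> \<bullet> \<alpha>) = of_int p * (\<alpha> \<bullet> \<alpha>)" "2 * (\<gamma> \<bullet> \<alpha>) = of_int g * (\<gamma> \<bullet> \<gamma>)"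
    "2 * (\<beta> \<bullet> \<alpha>) = - of_int q * (\<alpha> \<bullet> \<alpha>)" "2 * (\<beta> \<bullet> \<alpha>) = - of_int b * (\<gamma> \<bullet> \<gamma>)"
    "g \<ge> 1" "p \<ge> 1" "b \<ge> 0" "q \<ge> 0" "g * q = p * b"
proof -
  note roots = simple_root[OF \<alpha>(1)] simple_root[OF \<beta>]
  note pos = root_norm_pos[OF roots(1)] root_norm_pos[OF roots(2)] root_norm_pos[OF \<gamma>]
  obtain p where p: "2 * (\<gamma> \<bullet> \<alpha>) = of_int p * (\<alpha> \<bullet> \<alpha>)"
    using cartan_obtain[OF roots(1) \<gamma>] by blast
  obtain g where "2 * (\<alpha> \<bullet> \<gamma>) = of_int g * (\<gamma> \<bullet> \<gamma>)"
    using cartan_obtain[OF \<gamma> roots(1)] by blast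
  then have g: "2 * (\<gamma> \<bullet> \<alpha>) = of_int g * (\<gamma> \<bullet> \<gamma>)" by (simp add: inner_commute)
  obtain q' where q': "2 * (\<beta> \<bullet> \<alpha>) = of_int q' * (\<alpha> \<bullet> \<alpha>)"
    using cartan_obtain[OF roots(1,2)] by blast
  obtain b' where "2 * (\<alpha> \<bullet> \<beta>) = of_int b' * (\<beta> \<bullet> \<beta>)"
    using cartan_obtain[OF roots(2,1)] by blast
  then have b': "2 * (\<beta> \<bullet> \<alpha>) = of_int b' * (\<gamma> \<bullet> \<gamma>)" by (simp add: inner_commute norm)
  have "\<alpha> \<noteq> \<beta>" using assms(4) \<alpha>(2) by auto
  then have neg: "\<beta> \<bullet> \<alpha> \<le> 0" using simple_nonpos[OF \<beta> \<alpha>(1)] by blast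
  have "of_int g * (\<gamma> \<bullet> \<gamma>) > 0" "of_int p * (\<alpha> \<bullet> \<alpha>) > 0"
    using \<alpha>(2) p g by linarith+
  then have gp: "g \<ge> 1" "p \<ge> 1" using pos by (auto simp: zero_less_mult_iff)
  have "of_int b' * (\<gamma> \<bullet> \<gamma>) \<le> 0" "of_int q' * (\<alpha> \<bullet> \<alpha>) \<le> 0"
    using neg b' q' by linarith+
  then have bq: "- b' \<ge> 0" "- q' \<ge> 0" using pos by (auto simp: mult_le_0_iff)
  have "real_of_int (g * q') * ((\<gamma> \<bullet> \<gamma>) * (\<alpha> \<bullet> \<alpha>)) = (of_int g * (\<gamma> \<bullet> \<gamma>)) * (of_int q' * (\<alpha> \<bullet> \<alpha>))"
    by simp
  also have "\<dots> = (of_int p * (\<alpha> \<bullet> \<alpha>)) * (of_int b' * (\<gamma> \<bullet> \<gamma>))"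
    unfolding g[symmetric] p[symmetric] q'[symmetric] b'[symmetric] ..
  also have "\<dots> = real_of_int (p * b') * ((\<gamma> \<bullet> \<gamma>) * (\<alpha> \<bullet> \<alpha>))" by simp
  finally have "real_of_int (g * q') = real_of_int (p * b')"
    using pos by (metis mult_cancel_right mult_pos_pos less_irrefl)
  then have "g * q' = p * b'" using of_int_eq_iff by blast
  then have "g * (- q') = p * (- b')" by simp
  moreover have "2 * (\<beta> \<bullet> \<alpha>) = - of_int (- q') * (\<alpha> \<bullet> \<alpha>)" "2 * (\<beta> \<bullet> \<alpha>) = - of_int (- b') * (\<gamma> \<bullet> \<gamma>)"
    using q' b' by simp_all
  ultimately show thesis using that p g gp bq by blast
qed

lemma inner_self_nonpos: "(x :: 'a) \<bullet> x \<le> 0 \<Longrightarrow> x = 0"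
  by (simp flip: not_less)

text \<open>Here \<beta> and \<gamma> are short roots of a G_2 at 120 degrees, and \<gamma> -
  \<beta> is a long root of squared length \<open>3 * N\<close>. The integers allow \<alpha> to be
  -\<beta>, \<gamma>, 2\<gamma> + \<beta> or \<gamma> - \<beta>; only the last is compatible with
  simplicity and with \<gamma> - \<alpha> being a root.\<close>

lemma obtuse_string:
  assumes \<gamma>: "\<gamma> \<in> \<Delta>" and \<beta>: "\<beta> \<in> S" "\<gamma> - \<beta> \<in> \<Delta>" "\<gamma> \<bullet> \<beta> < 0" "\<gamma> \<noteq> - \<beta>"
    and \<alpha>: "\<alpha> \<in> S" "\<gamma> - \<alpha> \<in> \<Delta>" "\<gamma> \<bullet> \<alpha> > 0"
  shows "\<alpha> = \<gamma> - \<beta>"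
proof -
  note roots = simple_root[OF \<alpha>(1)] simple_root[OF \<beta>(1)]
  define N a where "N = \<gamma> \<bullet> \<gamma>" and "a = \<alpha> \<bullet> \<alpha>"
  have pos: "N > 0" "a > 0" unfolding N_def a_def using root_norm_pos \<gamma> roots by auto
  have add: "\<gamma> + \<beta> \<in> \<Delta>" using root_add[OF \<gamma> roots(2)] \<beta> by simp
  have norm: "\<beta> \<bullet> \<beta> = \<gamma> \<bullet> \<gamma>" using string_norm[OF \<gamma> roots(2) add \<beta>(2)] .
  obtain k :: int where k: "2 * (\<gamma> \<bullet> \<beta>) = of_int k * N"
    using cartan_obtain[OF roots(2) \<gamma>] norm unfolding N_def by metis
  have "(\<gamma> + \<beta>) \<bullet> (\<gamma> + \<beta>) > 0" using root_norm_pos[OF add] .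
  then have "2 * N + of_int k * N > 0"
    using k norm unfolding N_def by (simp add: inner_add inner_commute)
  then have "real_of_int (2 + k) * N > 0" by (simp add: distrib_right)
  then have "k > - 2" using pos by (simp add: zero_less_mult_iff)
  moreover have "of_int k * N < 0" using k \<beta>(3) by linarith
  then have "k < 0" using pos by (simp add: mult_less_0_iff)
  ultimately have "k = - 1" by simp
  then have gb: "\<gamma> \<bullet> \<beta> = - N / 2" using k by simp
  obtain g p b q :: int
    where p: "2 * (\<gamma> \<bullet> \<alpha>) = of_int p * a" and g: "2 * (\<gamma> \<bullet> \<alpha>) = of_int g * N"
    and q: "2 * (\<beta> \<bullet> \<alpha>) = - of_int q * a" and b: "2 * (\<beta> \<bullet> \<alpha>) = - of_int b * N"
    and ge: "g \<ge> 1" "p \<ge> 1" "b \<ge> 0" "q \<ge> 0" "g * q = p * b"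
    using cartan_pair_obtain[OF \<gamma> \<beta>(1) norm _ \<alpha>(1,3)] \<beta>(3) unfolding N_def a_def
    by (metis less_imp_le)
  obtain l :: int where l: "2 * (\<alpha> \<bullet> (\<gamma> - \<beta>)) = of_int l * ((\<gamma> - \<beta>) \<bullet> (\<gamma> - \<beta>))"
    using cartan_obtain[OF \<beta>(2) roots(1)] by blast
  have xx: "(\<gamma> - \<beta>) \<bullet> (\<gamma> - \<beta>) = 3 * N"
    using gb norm unfolding N_def by (simp add: inner_diff inner_commute)
  have "of_int (g + b) * N = of_int (3 * l) * N"
    using l g b unfolding xx by (simp add: inner_diff_right inner_commute algebra_simps)
  then have gbl: "g + b = 3 * l" using pos by (metis mult_cancel_right less_irrefl of_int_eq_iff)
  have "of_int (g * p) * (N * a) = (2 * (\<gamma> \<bullet> \<alpha>)) * (2 * (\<gamma> \<bullet> \<alpha>))"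
    by (subst (1) p, subst g) simp
  also have "\<dots> \<le> 4 * (N * a)"
    using Cauchy_Schwarz_ineq[of \<gamma> \<alpha>] unfolding N_def a_def by (simp add: power2_eq_square)
  finally have gp: "g * p \<le> 4" using pos by (simp only: mult_le_cancel_right_pos mult_pos_pos of_int_le_numeral_iff)
  have "of_int (b * q) * (N * a) = (2 * (\<beta> \<bullet> \<alpha>)) * (2 * (\<beta> \<bullet> \<alpha>))"
    by (subst (1) q, subst b) simp
  also have "\<dots> \<le> 4 * (N * a)"
    using Cauchy_Schwarz_ineq[of \<beta> \<alpha>] norm unfolding N_def a_def by (simp add: power2_eq_square)
  finally have bq: "b * q \<le> 4" using pos by (simp only: mult_le_cancel_right_pos mult_pos_pos of_int_le_numeral_iff)
  have "(g, p, b, q) \<in> {(1, 1, 2, 2), (2, 2, 1, 1), (3, 1, 0, 0), (3, 1, 3, 1)}"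
    using small_cases_mod3[OF gp bq ge(5) gbl ge(1-4)] .
  then consider "g = 1" "p = 1" "b = 2" | "g = 2" "p = 2" | "g = 3" "p = 1" "b = 0" | "g = 3" "p = 1" "b = 3"
    by auto
  then show ?thesis
  proof cases
    case 1
    then have "(\<alpha> + \<beta>) \<bullet> (\<alpha> + \<beta>) \<le> 0"
      using g p b norm unfolding N_def a_def by (simp add: inner_add inner_commute)
    then show ?thesis using inner_self_nonpos simple_sum_nonzero[OF \<alpha>(1) \<beta>(1)] by blast
  next
    case 2
    then have "(\<gamma> - \<alpha>) \<bullet> (\<gamma> - \<alpha>) \<le> 0"
      using g p unfolding N_def a_def by (simp add: inner_diff inner_commute)
    then show ?thesis using inner_self_nonpos \<alpha>(2) zero_notin by metis
  next
    case 3
    have \<alpha>_eq: "\<alpha> = \<gamma> + (\<gamma> + \<beta>)"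
    proof -
      have "(\<gamma> + (\<gamma> + \<beta>) - \<alpha>) \<bullet> (\<gamma> + (\<gamma> + \<beta>) - \<alpha>) \<le> 0"
        using 3 g p b gb norm unfolding N_def a_def by (simp add: inner_diff inner_add inner_commute)
      then show ?thesis using inner_self_nonpos by fastforce
    qed
    \<comment> \<open>Whichever of \<gamma> and -\<gamma> is positive, \<alpha> = 2\<gamma> +
      \<beta> decomposes \<alpha> or \<beta>.\<close>
    from \<gamma> show ?thesis
    proof (rule pos_cases)
      assume "\<gamma> \<in> P"
      then have "\<gamma> + \<beta> \<in> P" using pos_add add simple_pos \<beta>(1) by blast
      then show ?thesis using simple_indecomposable[OF \<alpha>(1) \<open>\<gamma> \<in> P\<close>] \<alpha>_eq by blast
    next
      assume neg: "- \<gamma> \<in> P"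
      have "\<alpha> + (- \<gamma>) \<in> P"
        using pos_add[OF simple_pos[OF \<alpha>(1)] neg] \<alpha>(2) root_diff_commute by simp
      then have "\<beta> \<noteq> (\<alpha> + (- \<gamma>)) + (- \<gamma>)" using simple_indecomposable[OF \<beta>(1) _ neg] by blast
      then show ?thesis using \<alpha>_eq by simp
    qed
  next
    case 4
    have "(\<gamma> - \<beta> - \<alpha>) \<bullet> (\<gamma> - \<beta> - \<alpha>) = (\<gamma> - \<beta>) \<bullet> (\<gamma> - \<beta>) - 2 * (\<gamma> \<bullet> \<alpha>) + 2 * (\<beta> \<bullet> \<alpha>) + a"
      unfolding a_def by (simp add: inner_diff inner_commute)
    then have "(\<gamma> - \<beta> - \<alpha>) \<bullet> (\<gamma> - \<beta> - \<alpha>) \<le> 0"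
      unfolding xx using 4 g p b by simp
    then show ?thesis using inner_self_nonpos by fastforce
  qed
qed

text \<open>Here \<beta> and \<gamma> are orthogonal short roots of a B_2 with long roots \<gamma> -
  \<beta> and \<gamma> + \<beta>. Besides two generic positions, \<alpha> can be the long root
  \<gamma> - \<beta> or, if the system is not reduced, half of it. The solutions \<alpha> = \<gamma>
  and \<alpha> = 2\<gamma> of the integer constraints are impossible for a simple \<alpha> with
  \<gamma> - \<alpha> a root.\<close>

lemma right_string:
  assumes \<gamma>: "\<gamma> \<in> \<Delta>" and \<beta>: "\<beta> \<in> S" "\<gamma> - \<beta> \<in> \<Delta>" "\<gamma> \<bullet> \<beta> = 0"
    and \<alpha>: "\<alpha> \<in> S" "\<gamma> - \<alpha> \<in> \<Delta>" "\<gamma> \<bullet> \<alpha> > 0"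
  shows "\<alpha> \<bullet> \<alpha> = \<gamma> \<bullet> \<gamma> \<and> 2 * (\<gamma> \<bullet> \<alpha>) = \<gamma> \<bullet> \<gamma> \<and> 2 * (\<beta> \<bullet> \<alpha>) = - (\<gamma> \<bullet> \<gamma>) \<or>
    \<alpha> \<bullet> \<alpha> = 2 * (\<gamma> \<bullet> \<gamma>) \<and> \<gamma> \<bullet> \<alpha> = \<gamma> \<bullet> \<gamma> \<and> \<beta> \<bullet> \<alpha> = 0 \<or>
    \<alpha> = \<gamma> - \<beta> \<or> \<alpha> + \<alpha> = \<gamma> - \<beta>"
proof -
  note roots = simple_root[OF \<alpha>(1)] simple_root[OF \<beta>(1)]
  define N a where "N = \<gamma> \<bullet> \<gamma>" and "a = \<alpha> \<bullet> \<alpha>"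
  have pos: "N > 0" "a > 0" unfolding N_def a_def using root_norm_pos \<gamma> roots by auto
  have "reflection \<beta> (\<gamma> - \<beta>) = \<gamma> + \<beta>"
    using \<beta>(3) root_norm_pos[OF roots(2)] unfolding reflection_def
    by (simp add: inner_diff_left scaleR_2)
  then have add: "\<gamma> + \<beta> \<in> \<Delta>" using reflection_root[OF roots(2) \<beta>(2)] by simp
  have norm: "\<beta> \<bullet> \<beta> = \<gamma> \<bullet> \<gamma>" using string_norm[OF \<gamma> roots(2) add \<beta>(2)] .
  obtain g p b q :: int
    where p: "2 * (\<gamma> \<bullet> \<alpha>) = of_int p * a" and g: "2 * (\<gamma> \<bullet> \<alpha>) = of_int g * N"
    and q: "2 * (\<beta> \<bullet> \<alpha>) = - of_int q * a" and b: "2 * (\<beta> \<bullet> \<alpha>) = - of_int b * N"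
    and ge: "g \<ge> 1" "p \<ge> 1" "b \<ge> 0" "q \<ge> 0" "g * q = p * b"
    using cartan_pair_obtain[OF \<gamma> \<beta>(1) norm _ \<alpha>(1,3)] \<beta>(3) unfolding N_def a_def
    by (metis order_refl)
  obtain l :: int where l: "2 * (\<alpha> \<bullet> (\<gamma> - \<beta>)) = of_int l * ((\<gamma> - \<beta>) \<bullet> (\<gamma> - \<beta>))"
    using cartan_obtain[OF \<beta>(2) roots(1)] by blast
  have xx: "(\<gamma> - \<beta>) \<bullet> (\<gamma> - \<beta>) = 2 * N"
    using \<beta>(3) norm unfolding N_def by (simp add: inner_diff inner_commute)
  have "of_int (g + b) * N = of_int (2 * l) * N"
    using l g b unfolding xx by (simp add: inner_diff_right inner_commute algebra_simps)
  then have gbl: "g + b = 2 * l" using pos by (metis mult_cancel_right less_irrefl of_int_eq_iff)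
  \<comment> \<open>\<open>?y\<close> is the component of \<alpha> orthogonal to \<gamma> and
    \<beta>, so \<open>?y \<bullet> ?y \<ge> 0\<close> is Bessel's inequality.\<close>
  let ?y = "\<alpha> - (of_int g / 2) *\<^sub>R \<gamma> + (of_int b / 2) *\<^sub>R \<beta>"
  have "?y \<bullet> ?y = a - of_int g * (\<gamma> \<bullet> \<alpha>) + of_int b * (\<beta> \<bullet> \<alpha>) + (of_int g / 2)\<^sup>2 * N + (of_int b / 2)\<^sup>2 * N"
    using \<beta>(3) norm unfolding a_def N_def
    by (simp add: inner_diff inner_add inner_commute power2_eq_square algebra_simps)
  also have "\<dots> = a - of_int g * (2 * (\<gamma> \<bullet> \<alpha>)) / 4 + of_int b * (2 * (\<beta> \<bullet> \<alpha>)) / 4"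
  proof -
    have "(of_int g / 2)\<^sup>2 * N = of_int g * (2 * (\<gamma> \<bullet> \<alpha>)) / 4" "(of_int b / 2)\<^sup>2 * N = - of_int b * (2 * (\<beta> \<bullet> \<alpha>)) / 4"
      by (subst g b, simp add: power2_eq_square)+
    then show ?thesis by simp
  qed
  also have "\<dots> = (4 - of_int (g * p + b * q)) * a / 4"
    unfolding p q by (simp add: field_simps)
  finally have "(4 - of_int (g * p + b * q)) * a \<ge> 0" by (metis inner_ge_zero zero_le_divide_iff zero_less_numeral not_le divide_less_0_iff)
  then have "real_of_int (g * p + b * q) \<le> 4"
    using pos by (simp add: zero_le_mult_iff del: of_int_add of_int_mult)
  then have gp: "g * p + b * q \<le> 4" by (simp only: of_int_le_numeral_iff)
  have "(g, p, b, q) \<in> {(1, 1, 1, 1), (1, 2, 1, 2), (2, 1, 0, 0), (2, 1, 2, 1), (2, 2, 0, 0), (4, 1, 0, 0)}"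
    using small_cases_mod2[OF gp ge(5) gbl ge(1-4)] .
  then consider "g = 1" "p = 1" "b = 1" | "g = 1" "p = 2" "b = 1" | "g = 2" "p = 1" "b = 0"
    | "g = 2" "p = 1" "b = 2" | "g = 2" "p = 2" | "g = 4" "p = 1"
    by auto
  then show ?thesis
  proof cases
    case 1
    then show ?thesis using g p b unfolding N_def a_def by simp
  next
    case 2
    have "(\<gamma> - \<beta> - (\<alpha> + \<alpha>)) \<bullet> (\<gamma> - \<beta> - (\<alpha> + \<alpha>)) = (\<gamma> - \<beta>) \<bullet> (\<gamma> - \<beta>) - 4 * (\<gamma> \<bullet> \<alpha>) + 4 * (\<beta> \<bullet> \<alpha>) + 4 * a"
      unfolding a_def by (simp add: inner_diff inner_add inner_commute)
    then have "(\<gamma> - \<beta> - (\<alpha> + \<alpha>)) \<bullet> (\<gamma> - \<beta> - (\<alpha> + \<alpha>)) \<le> 0"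
      unfolding xx using 2 g p b by simp
    then have "\<gamma> - \<beta> - (\<alpha> + \<alpha>) = 0" using inner_self_nonpos by blast
    then show ?thesis by simp
  next
    case 3
    then show ?thesis using g p b unfolding N_def a_def by simp
  next
    case 4
    have "(\<gamma> - \<beta> - \<alpha>) \<bullet> (\<gamma> - \<beta> - \<alpha>) = (\<gamma> - \<beta>) \<bullet> (\<gamma> - \<beta>) - 2 * (\<gamma> \<bullet> \<alpha>) + 2 * (\<beta> \<bullet> \<alpha>) + a"
      unfolding a_def by (simp add: inner_diff inner_commute)
    then have "(\<gamma> - \<beta> - \<alpha>) \<bullet> (\<gamma> - \<beta> - \<alpha>) \<le> 0"
      unfolding xx using 4 g p b by simp
    then show ?thesis using inner_self_nonpos by fastforce
  next
    case 5
    then have "(\<gamma> - \<alpha>) \<bullet> (\<gamma> - \<alpha>) \<le> 0"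
      using g p unfolding N_def a_def by (simp add: inner_diff inner_commute)
    then show ?thesis using inner_self_nonpos \<alpha>(2) zero_notin by metis
  next
    case 6
    then have "(\<gamma> + \<gamma> - \<alpha>) \<bullet> (\<gamma> + \<gamma> - \<alpha>) \<le> 0"
      using g p unfolding N_def a_def by (simp add: inner_diff inner_add inner_commute)
    then have \<alpha>_eq: "\<alpha> = \<gamma> + \<gamma>" using inner_self_nonpos by fastforce
    from \<gamma> show ?thesis
    proof (rule pos_cases)
      assume "\<gamma> \<in> P"
      then show ?thesis using simple_indecomposable[OF \<alpha>(1)] \<alpha>_eq by blast
    next
      assume "- \<gamma> \<in> P"
      then show ?thesis using pos_inner[OF simple_pos[OF \<alpha>(1)]] pos_inner[of "- \<gamma>"] \<alpha>_eq
        by (simp add: inner_add_right)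
    qed
  qed
qed

text \<open>The orthogonal case is beyond \<open>root_add\<close>: there the reflection in \<alpha>
  fixes \<gamma> and takes \<gamma> - \<alpha> to \<gamma> + \<alpha>.\<close>

lemma root_add_nonacute:
  assumes "\<gamma> \<in> \<Delta>" "\<alpha> \<in> \<Delta>" "\<gamma> - \<alpha> \<in> \<Delta>" "\<gamma> \<bullet> \<alpha> \<le> 0" "\<gamma> \<noteq> - \<alpha>"
  shows "\<gamma> + \<alpha> \<in> \<Delta>"
proof (cases "\<gamma> \<bullet> \<alpha> = 0")
  case True
  then have "reflection \<alpha> (\<gamma> - \<alpha>) = \<gamma> + \<alpha>"
    using root_norm_pos[OF assms(2)] unfolding reflection_def by (simp add: inner_diff_left scaleR_2)
  then show ?thesis using reflection_root[OF assms(2,3)] by simp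
next
  case False
  then show ?thesis using root_add assms by simp
qed

section \<open>Simple roots whose double is a root\<close>

text \<open>Orthogonality would make \<alpha> - \<beta> a root, so the angle is obtuse and 2\<beta>
  + \<alpha> is a root. Hence \<beta> + \<alpha> has the length of \<beta> by
  \<open>string_norm\<close>, and integrality against the coroot of 2\<beta> fixes the inner
  product.\<close>

lemma double_simple_root_neighbor:
  assumes \<beta>: "\<beta> \<in> S" "\<beta> + \<beta> \<in> \<Delta>" and \<alpha>: "\<alpha> \<in> S" "\<alpha> \<noteq> \<beta>" "\<beta> + \<alpha> \<in> \<Delta>"
  shows "\<alpha> \<bullet> \<alpha> = 2 * (\<beta> \<bullet> \<beta>)" "\<beta> \<bullet> \<alpha> = - (\<beta> \<bullet> \<beta>)"
proof -
  note roots = simple_root[OF \<beta>(1)] simple_root[OF \<alpha>(1)]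
  have "\<beta> \<bullet> \<alpha> \<noteq> 0"
  proof
    assume 0: "\<beta> \<bullet> \<alpha> = 0"
    have "- \<beta> + \<alpha> \<in> \<Delta>"
    proof (rule root_add_nonacute)
      show "- \<beta> - \<alpha> \<in> \<Delta>" using root_uminus[OF \<alpha>(3)] by simp
    qed (use 0 roots root_uminus \<alpha>(2) in auto)
    then show False using simple_diff_not_root[OF \<alpha>(1) \<beta>(1)] by simp
  qed
  then have neg: "\<beta> \<bullet> \<alpha> < 0" using simple_nonpos[OF \<beta>(1) \<alpha>(1)] \<alpha>(2) by force
  have ne: "\<beta> + \<beta> \<noteq> - \<alpha>"
  proof
    assume "\<beta> + \<beta> = - \<alpha>"
    then have "v \<bullet> (\<beta> + \<beta>) = v \<bullet> (- \<alpha>)" by simp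
    then show False using pos_inner simple_pos \<alpha>(1) \<beta>(1) by (smt (verit) inner_add_right inner_minus_right)
  qed
  have add: "\<beta> + \<beta> + \<alpha> \<in> \<Delta>"
    using root_add[OF \<beta>(2) roots(2) _ ne] neg by (simp add: inner_add_left)
  have "\<beta> \<bullet> \<beta> = (\<beta> + \<alpha>) \<bullet> (\<beta> + \<alpha>)"
    using string_norm[OF \<alpha>(3) roots(1)] add roots(2) by (simp add: add_ac)
  then have a: "\<alpha> \<bullet> \<alpha> = - 2 * (\<beta> \<bullet> \<alpha>)" by (simp add: inner_add inner_commute)
  obtain k where "2 * (\<alpha> \<bullet> (\<beta> + \<beta>)) = of_int k * ((\<beta> + \<beta>) \<bullet> (\<beta> + \<beta>))"
    using cartan_obtain[OF \<beta>(2) roots(2)] by blast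
  then have k: "\<beta> \<bullet> \<alpha> = of_int k * (\<beta> \<bullet> \<beta>)"
    by (simp add: inner_add inner_commute algebra_simps)
  have "(\<beta> + \<beta> + \<alpha>) \<bullet> (\<beta> + \<beta> + \<alpha>) > 0" using root_norm_pos[OF add] .
  then have "(4 + 2 * of_int k) * (\<beta> \<bullet> \<beta>) > 0"
    using a k by (simp add: inner_add inner_commute algebra_simps)
  then have "real_of_int k > - 2" using root_norm_pos[OF roots(1)] by (simp add: zero_less_mult_iff)
  then have "k > - 2" by linarith
  moreover have "of_int k * (\<beta> \<bullet> \<beta>) < 0" using neg k by simp
  then have "k < 0"
    using root_norm_pos[OF roots(1)] by (simp add: mult_less_0_iff del: inner_gt_zero_iff)
  ultimately have "k = - 1" by simp
  then show "\<alpha> \<bullet> \<alpha> = 2 * (\<beta> \<bullet> \<beta>)" "\<beta> \<bullet> \<alpha> = - (\<beta> \<bullet> \<beta>)" using k a by simp_all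
qed

text \<open>The case \<open>\<gamma> = - \<beta>\<close> of \<open>simple_down_set\<close>.
  \<open>T\<close> may contain \<beta> itself; two further elements \<alpha> and \<alpha>' would
  give 2\<beta> + \<alpha> + \<alpha>' nonpositive squared length, although \<open>v\<close> is
  positive on it.\<close>

lemma double_simple_root_card:
  assumes \<beta>: "\<beta> \<in> S" "\<beta> + \<beta> \<in> \<Delta>" and T: "T \<subseteq> S" "\<And>\<alpha>. \<alpha> \<in> T \<Longrightarrow> \<beta> + \<alpha> \<in> \<Delta>"
  shows "card T \<le> 2"
proof -
  have "finite T" using T(1) finite_subset finite_simple by blast
  have "\<alpha> = \<alpha>'" if "\<alpha> \<in> T - {\<beta>}" "\<alpha>' \<in> T - {\<beta>}" for \<alpha> \<alpha>'
  proof (rule ccontr)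
    assume ne: "\<alpha> \<noteq> \<alpha>'"
    have s: "\<alpha> \<in> S" "\<alpha>' \<in> S" using that T by auto
    have "\<alpha> \<bullet> \<alpha>' \<le> 0" using simple_nonpos[OF s ne] .
    moreover have "\<alpha> \<bullet> \<alpha> = 2 * (\<beta> \<bullet> \<beta>)" "\<beta> \<bullet> \<alpha> = - (\<beta> \<bullet> \<beta>)" "\<alpha>' \<bullet> \<alpha>' = 2 * (\<beta> \<bullet> \<beta>)" "\<beta> \<bullet> \<alpha>' = - (\<beta> \<bullet> \<beta>)"
      using double_simple_root_neighbor[OF \<beta>] that s T(2) by auto
    ultimately have "(\<beta> + \<beta> + \<alpha> + \<alpha>') \<bullet> (\<beta> + \<beta> + \<alpha> + \<alpha>') \<le> 0"
      by (simp add: inner_add inner_commute)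
    then have "v \<bullet> (\<beta> + \<beta> + \<alpha> + \<alpha>') = 0" using inner_self_nonpos by force
    then show False
      using pos_inner[OF simple_pos[OF s(1)]] pos_inner[OF simple_pos[OF s(2)]]
        pos_inner[OF simple_pos[OF \<beta>(1)]] by (simp add: inner_add_right)
  qed
  then have "card (T - {\<beta>}) \<le> 1"
    using \<open>finite T\<close> by (simp add: card_le_Suc0_iff_eq)
  then show ?thesis
    using \<open>finite T\<close> card_Diff_singleton_if[of T \<beta>] by (auto split: if_splits)
qed

text \<open>
  The two generic positions of \<open>\<alpha>\<close> left open by \<open>right_string\<close>, where \<open>\<gamma>\<close> and \<open>\<beta>\<close> are orthogonal of
  equal length. Both occur together in type \<open>F\<^sub>4\<close>.
\<close>

definition medium :: "'a \<Rightarrow> 'a \<Rightarrow> 'a \<Rightarrow> bool" where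
  "medium \<gamma> \<beta> \<alpha> \<longleftrightarrow> \<alpha> \<bullet> \<alpha> = \<gamma> \<bullet> \<gamma> \<and> 2 * (\<gamma> \<bullet> \<alpha>) = \<gamma> \<bullet> \<gamma> \<and> 2 * (\<beta> \<bullet> \<alpha>) = - (\<gamma> \<bullet> \<gamma>)"

definition large :: "'a \<Rightarrow> 'a \<Rightarrow> 'a \<Rightarrow> bool" where
  "large \<gamma> \<beta> \<alpha> \<longleftrightarrow> \<alpha> \<bullet> \<alpha> = 2 * (\<gamma> \<bullet> \<gamma>) \<and> \<gamma> \<bullet> \<alpha> = \<gamma> \<bullet> \<gamma> \<and> \<beta> \<bullet> \<alpha> = 0"

text \<open>The vector \<alpha> + \<alpha>' - (\<gamma> - \<beta>) has squared length
  \<open>2 * (\<alpha> \<bullet> \<alpha>')\<close>, so it vanishes, and \<alpha>, \<alpha>' are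
  orthogonal with a root as their sum. Then their difference is a root as well, which simple roots
  forbid.\<close>

lemma medium_unique:
  assumes "\<beta> \<in> S" "\<gamma> \<bullet> \<beta> = 0" "\<beta> \<bullet> \<beta> = \<gamma> \<bullet> \<gamma>" "\<gamma> - \<beta> \<in> \<Delta>"
    and S: "\<alpha> \<in> S" "\<alpha>' \<in> S" and "medium \<gamma> \<beta> \<alpha>" "medium \<gamma> \<beta> \<alpha>'"
  shows "\<alpha> = \<alpha>'"
proof (rule ccontr)
  assume ne: "\<alpha> \<noteq> \<alpha>'"
  have np: "\<alpha> \<bullet> \<alpha>' \<le> 0" using simple_nonpos[OF S ne] .
  have e: "(\<alpha> + \<alpha>' - (\<gamma> - \<beta>)) \<bullet> (\<alpha> + \<alpha>' - (\<gamma> - \<beta>)) = 2 * (\<alpha> \<bullet> \<alpha>')"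
    using assms unfolding medium_def by (simp add: inner_add inner_diff inner_commute)
  then have "(\<alpha> + \<alpha>' - (\<gamma> - \<beta>)) \<bullet> (\<alpha> + \<alpha>' - (\<gamma> - \<beta>)) \<le> 0" using np by linarith
  then have "\<alpha> + \<alpha>' - (\<gamma> - \<beta>) = 0" by (rule inner_self_nonpos)
  then have sum: "\<alpha> + \<alpha>' \<in> \<Delta>" and "\<alpha> \<bullet> \<alpha>' = 0" using assms(4) e by simp_all
  have "- \<alpha> + \<alpha>' \<in> \<Delta>"
  proof (rule root_add_nonacute)
    show "- \<alpha> - \<alpha>' \<in> \<Delta>" using root_uminus[OF sum] by simp
  qed (use \<open>\<alpha> \<bullet> \<alpha>' = 0\<close> S simple_root root_uminus ne in auto)
  then show False using simple_diff_not_root[OF S(2,1)] by simp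
qed

text \<open>As \<open>\<alpha> \<bullet> \<alpha>' \<le> 0\<close>, the vector \<alpha> + \<alpha>'
  - 2\<gamma> vanishes. So \<gamma> - \<alpha> and \<gamma> - \<alpha>' are opposite roots, and
  adding the positive one to the positive root \<gamma> decomposes a simple root.\<close>

lemma large_unique:
  assumes \<gamma>: "\<gamma> \<in> \<Delta>" and S: "\<alpha> \<in> S" "\<alpha>' \<in> S" and "large \<gamma> \<beta> \<alpha>" "large \<gamma> \<beta> \<alpha>'"
    and down: "\<gamma> - \<alpha> \<in> \<Delta>" "\<gamma> - \<alpha>' \<in> \<Delta>"
  shows "\<alpha> = \<alpha>'"
proof (rule ccontr)
  assume ne: "\<alpha> \<noteq> \<alpha>'"
  have "\<alpha> \<bullet> \<alpha>' \<le> 0" using simple_nonpos[OF S ne] .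
  then have "(\<alpha> + \<alpha>' - (\<gamma> + \<gamma>)) \<bullet> (\<alpha> + \<alpha>' - (\<gamma> + \<gamma>)) \<le> 0"
    using assms(4,5) unfolding large_def by (simp add: inner_add inner_diff inner_commute)
  then have sum: "\<alpha> + \<alpha>' = \<gamma> + \<gamma>" using inner_self_nonpos by force
  have "v \<bullet> (\<gamma> + \<gamma>) > 0"
    unfolding sum[symmetric] using pos_inner simple_pos S by (simp add: inner_add_right add_pos_pos)
  then have pos: "\<gamma> \<in> P" using \<gamma> by (intro posI) (auto simp: inner_add_right)
  have "\<alpha> = \<gamma> + (\<gamma> - \<alpha>')" "\<alpha>' = \<gamma> + (\<gamma> - \<alpha>)" using sum by (simp_all add: algebra_simps)
  moreover have "\<gamma> - \<alpha>' = - (\<gamma> - \<alpha>)" using sum by (simp add: algebra_simps)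
  ultimately show False
    using pos_cases[OF down(1)] simple_indecomposable S pos by metis
qed

text \<open>In units of \<open>N\<close> all inner products are known except that of \<alpha> and
  \<alpha>', an integer \<open>i\<close> because \<alpha>' has squared length \<open>2 * N\<close>.
  Pairing a relation with \<beta>, \<alpha>, \<alpha>' and \<gamma> overdetermines its coefficients
  and leaves an equation in \<open>i\<close> whose sides differ in parity.\<close>

lemma medium_large_not_in_span:
  assumes \<gamma>: "\<gamma> \<in> \<Delta>" and "\<beta> \<in> S" "\<gamma> \<bullet> \<beta> = 0" "\<beta> \<bullet> \<beta> = \<gamma> \<bullet> \<gamma>"
    and S: "\<alpha> \<in> S" "\<alpha>' \<in> S" "\<alpha> \<noteq> \<alpha>'" and m: "medium \<gamma> \<beta> \<alpha>" and l: "large \<gamma> \<beta> \<alpha>'"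
  shows "\<gamma> \<notin> span {\<beta>, \<alpha>, \<alpha>'}"
proof
  assume "\<gamma> \<in> span {\<beta>, \<alpha>, \<alpha>'}"
  then obtain k0 k1 k2 where "\<gamma> - k0 *\<^sub>R \<beta> - k1 *\<^sub>R \<alpha> - k2 *\<^sub>R \<alpha>' = 0"
    by (auto simp: span_breakdown_eq)
  then have k: "\<gamma> = k0 *\<^sub>R \<beta> + k1 *\<^sub>R \<alpha> + k2 *\<^sub>R \<alpha>'" by (simp add: algebra_simps)
  define N where "N = \<gamma> \<bullet> \<gamma>"
  have N: "N > 0" unfolding N_def using root_norm_pos[OF \<gamma>] .
  obtain i :: int where "2 * (\<alpha> \<bullet> \<alpha>') = of_int i * (\<alpha>' \<bullet> \<alpha>')"
    using cartan_obtain[OF simple_root simple_root] S by blast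
  then have i: "\<alpha> \<bullet> \<alpha>' = of_int i * N" using l unfolding large_def N_def by simp
  have ip: "\<beta> \<bullet> \<beta> = N" "\<alpha> \<bullet> \<alpha> = N" "\<alpha>' \<bullet> \<alpha>' = 2 * N" "\<beta> \<bullet> \<gamma> = 0" "\<alpha> \<bullet> \<gamma> = N / 2" "\<alpha>' \<bullet> \<gamma> = N"
    "\<beta> \<bullet> \<alpha> = - N / 2" "\<alpha> \<bullet> \<beta> = - N / 2" "\<beta> \<bullet> \<alpha>' = 0" "\<alpha>' \<bullet> \<beta> = 0" "\<alpha>' \<bullet> \<alpha> = of_int i * N"
    using assms(3,4) m l i unfolding N_def medium_def large_def by (simp_all add: inner_commute)
  have cancel: "c = d" if "c * N = d * N" for c d using that N by simp
  have "\<beta> \<bullet> \<gamma> = k0 * N - k1 * N / 2"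
    by (subst k) (simp add: inner_add_right ip)
  also have "\<dots> = (k0 - k1 / 2) * N" by (simp add: left_diff_distrib)
  finally have "\<beta> \<bullet> \<gamma> = (k0 - k1 / 2) * N" .
  then have "k0 - k1 / 2 = 0" using ip(4) by - (rule cancel, simp)
  then have 1: "k1 = 2 * k0" by simp
  have "\<alpha> \<bullet> \<gamma> = - k0 * N / 2 + k1 * N + k2 * (of_int i * N)"
    by (subst k) (simp add: inner_add_right ip i)
  also have "\<dots> = (- k0 / 2 + k1 + k2 * of_int i) * N" by (simp add: distrib_right left_diff_distrib)
  finally have "\<alpha> \<bullet> \<gamma> = (- k0 / 2 + k1 + k2 * of_int i) * N" .
  then have "- k0 / 2 + k1 + k2 * of_int i = 1 / 2" using ip(5) by - (rule cancel, simp)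
  then have 2: "1 + k0 - 2 * k1 - 2 * k2 * of_int i = 0" by simp
  have "\<alpha>' \<bullet> \<gamma> = k1 * (of_int i * N) + k2 * (2 * N)"
    by (subst k) (simp add: inner_add_right ip)
  also have "\<dots> = (k1 * of_int i + 2 * k2) * N" by (simp add: distrib_right)
  finally have "\<alpha>' \<bullet> \<gamma> = (k1 * of_int i + 2 * k2) * N" .
  then have "k1 * of_int i + 2 * k2 = 1" using ip(6) by - (rule cancel, simp)
  then have 3: "1 - k1 * of_int i - 2 * k2 = 0" by simp
  have "\<gamma> \<bullet> \<gamma> = k0 * (\<beta> \<bullet> \<gamma>) + k1 * (\<alpha> \<bullet> \<gamma>) + k2 * (\<alpha>' \<bullet> \<gamma>)"
    by (subst k) (simp add: inner_add_left)
  then have "(k1 / 2 + k2) * N = 1 * N" using ip N_def by (simp add: algebra_simps)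
  then have "k1 / 2 + k2 = 1" by (rule cancel)
  then have 4: "k2 = 1 - k0" using 1 by simp
  define j where "j = real_of_int (- i)"
  have i': "of_int i = - j" unfolding j_def by simp
  have 5: "2 * k0 * (1 + j) = 1" using 3 unfolding 1 4 i' by (simp add: algebra_simps)
  have 6: "1 = 3 * k0 - 2 * (1 - k0) * j" using 2 unfolding 1 4 i' by (simp add: algebra_simps)
  \<comment> \<open>Multiplying equation \<open>6\<close> by \<open>2 * (1 + j)\<close> lets
    equation \<open>5\<close> eliminate \<open>k0\<close>.\<close>
  have "2 * (1 + j) = 2 * (1 + j) * (3 * k0 - 2 * (1 - k0) * j)" unfolding 6[symmetric] by simp
  also have "\<dots> = 3 * (2 * k0 * (1 + j)) - 2 * j * (2 * (1 + j) - 2 * k0 * (1 + j))"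
    by (simp add: algebra_simps)
  also have "\<dots> = 3 - 2 * j * (2 * (1 + j) - 1)" unfolding 5 by simp
  finally have "real_of_int (2 * (1 - i)) = real_of_int (3 + 2 * i * (2 * (1 - i) - 1))"
    unfolding j_def by simp
  then have "2 * (1 - i) = 3 + 2 * i * (2 * (1 - i) - 1)" by (simp only: of_int_eq_iff)
  moreover have "even (2 * (1 - i))" "odd (3 + 2 * i * (2 * (1 - i) - 1))" by simp_all
  ultimately show False by metis
qed

text \<open>\<gamma> may be negative, so that the lemma also bounds what can be added to a positive
  root. If \<beta> in \<open>T\<close> is not at an acute angle and
  \<open>\<gamma> \<noteq> - \<beta>\<close>, then \<gamma> + \<beta> is a root and \<beta> is the
  only such element by \<open>simple_string_unique\<close>; three elements can then only be \<beta>,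
  one \<open>medium\<close> and one \<open>large\<close> root.\<close>

lemma simple_down_set:
  assumes \<gamma>: "\<gamma> \<in> \<Delta>" and T: "T \<subseteq> S" and down: "\<And>\<alpha>. \<alpha> \<in> T \<Longrightarrow> \<gamma> - \<alpha> \<in> \<Delta>"
  shows "card T \<le> 3 \<and> (card T = 3 \<longrightarrow> \<gamma> \<notin> span T)"
proof (cases "\<forall>\<alpha>\<in>T. \<gamma> \<bullet> \<alpha> > 0")
  case True
  then show ?thesis
    using acute_simple_card_le_3[OF \<gamma> T] acute_simple_not_in_span[OF \<gamma> T] by force
next
  case False
  then obtain \<beta> where \<beta>: "\<beta> \<in> T" "\<gamma> \<bullet> \<beta> \<le> 0" by force
  have fin: "finite T" using T finite_subset finite_simple by blast
  have \<beta>S: "\<beta> \<in> S" using \<beta> T by blast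
  note \<beta>R = simple_root[OF \<beta>S]
  have ?thesis if "card T \<le> 2" using that by simp
  moreover have "card T \<le> 2" if "\<gamma> = - \<beta>"
  proof (rule double_simple_root_card[OF \<beta>S _ T])
    have "\<beta> + \<alpha> = - (\<gamma> - \<alpha>)" for \<alpha> using that by simp
    then show *: "\<beta> + \<alpha> \<in> \<Delta>" if "\<alpha> \<in> T" for \<alpha>
      using down[OF that] root_uminus by presburger
    show "\<beta> + \<beta> \<in> \<Delta>" using *[OF \<beta>(1)] .
  qed
  moreover have ?thesis if ne: "\<gamma> \<noteq> - \<beta>"
  proof -
    note down\<beta> = down[OF \<beta>(1)]
    have add: "\<gamma> + \<beta> \<in> \<Delta>" using root_add_nonacute[OF \<gamma> \<beta>R down\<beta> \<beta>(2) ne] .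
    have acute: "\<gamma> \<bullet> \<alpha> > 0" if \<alpha>: "\<alpha> \<in> T" "\<alpha> \<noteq> \<beta>" for \<alpha>
    proof (rule ccontr)
      assume np: "\<not> \<gamma> \<bullet> \<alpha> > 0"
      have \<alpha>S: "\<alpha> \<in> S" using \<alpha> T by blast
      show False
      proof (cases "\<gamma> = - \<alpha>")
        case True
        then show False using add simple_diff_not_root[OF \<beta>S \<alpha>S] by simp
      next
        case False
        then have "\<gamma> + \<alpha> \<in> \<Delta>"
          using root_add_nonacute[OF \<gamma> simple_root[OF \<alpha>S] down[OF \<alpha>(1)]] np by simp
        then show False
          using simple_string_unique[OF \<gamma> \<alpha>S \<beta>S _ down[OF \<alpha>(1)] add down\<beta>] \<alpha>(2) by blast
      qed
    qed
    have cardT: "card T = Suc (card (T - {\<beta>}))"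
      using card.remove[OF fin \<beta>(1)] .
    show ?thesis
    proof (cases "\<gamma> \<bullet> \<beta> = 0")
      case False
      have "\<alpha> = \<gamma> - \<beta>" if "\<alpha> \<in> T - {\<beta>}" for \<alpha>
        using obtuse_string[OF \<gamma> \<beta>S down\<beta> _ ne, of \<alpha>] False \<beta>(2) that T down acute by force
      then have "T - {\<beta>} \<subseteq> {\<gamma> - \<beta>}" by blast
      from card_mono[OF _ this] show ?thesis using cardT by simp
    next
      case orth: True
      have norm: "\<beta> \<bullet> \<beta> = \<gamma> \<bullet> \<gamma>" using string_norm[OF \<gamma> \<beta>R add down\<beta>] .
      show ?thesis
      proof (cases "\<exists>\<alpha>\<in>T - {\<beta>}. \<alpha> = \<gamma> - \<beta> \<or> \<alpha> + \<alpha> = \<gamma> - \<beta>")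
        case True
        then obtain \<alpha> where \<alpha>: "\<alpha> \<in> T - {\<beta>}" "\<alpha> = \<gamma> - \<beta> \<or> \<alpha> + \<alpha> = \<gamma> - \<beta>" by blast
        \<comment> \<open>Another \<alpha>' would pair positively with \<gamma> - \<beta>, a
          positive multiple of \<alpha>, although distinct simple roots pair nonpositively.\<close>
        have "\<alpha>' = \<alpha>" if \<alpha>': "\<alpha>' \<in> T - {\<beta>}" for \<alpha>'
        proof (rule ccontr)
          assume "\<alpha>' \<noteq> \<alpha>"
          then have "\<alpha> \<bullet> \<alpha>' \<le> 0" "\<beta> \<bullet> \<alpha>' \<le> 0"
            using simple_nonpos \<alpha> \<alpha>' T \<beta>S by blast+
          moreover have "\<gamma> \<bullet> \<alpha>' > 0" using acute \<alpha>' by blast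
          moreover have "\<alpha> \<bullet> \<alpha>' = (\<gamma> - \<beta>) \<bullet> \<alpha>' \<or> 2 * (\<alpha> \<bullet> \<alpha>') = (\<gamma> - \<beta>) \<bullet> \<alpha>'"
            using \<alpha>(2) by (metis inner_add_left mult_2)
          ultimately show False by (simp add: inner_diff_left)
        qed
        then have "T - {\<beta>} \<subseteq> {\<alpha>}" by blast
        from card_mono[OF _ this] show ?thesis using cardT by simp
      next
        case False
        define U1 where "U1 = {\<alpha> \<in> T - {\<beta>}. medium \<gamma> \<beta> \<alpha>}"
        define U2 where "U2 = {\<alpha> \<in> T - {\<beta>}. large \<gamma> \<beta> \<alpha>}"
        have U: "T - {\<beta>} = U1 \<union> U2"
        proof -
          have "medium \<gamma> \<beta> \<alpha> \<or> large \<gamma> \<beta> \<alpha>" if "\<alpha> \<in> T - {\<beta>}" for \<alpha>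
            using right_string[OF \<gamma> \<beta>S down\<beta> orth, of \<alpha>] False that T down acute
            unfolding medium_def large_def by blast
          then show ?thesis unfolding U1_def U2_def by blast
        qed
        have fin12: "finite U1" "finite U2" unfolding U1_def U2_def using fin by auto
        have "\<alpha> = \<alpha>'" if "\<alpha> \<in> U1" "\<alpha>' \<in> U1" for \<alpha> \<alpha>'
          using medium_unique[OF \<beta>S orth norm down\<beta>, of \<alpha> \<alpha>'] that T unfolding U1_def by blast
        then have c1: "card U1 \<le> Suc 0" using card_le_Suc0_iff_eq[OF fin12(1)] by blast
        have "\<alpha> = \<alpha>'" if "\<alpha> \<in> U2" "\<alpha>' \<in> U2" for \<alpha> \<alpha>'
          using large_unique[OF \<gamma>, of \<alpha> \<alpha>' \<beta>] that T down unfolding U2_def by blast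
        then have c2: "card U2 \<le> Suc 0" using card_le_Suc0_iff_eq[OF fin12(2)] by blast
        note c12 = card_Un_le[of U1 U2]
        have eq: "card U1 = 1 \<and> card U2 = 1 \<and> card (U1 \<union> U2) = 2" if "card T = 3"
          using cardT that c1 c2 c12 unfolding U by linarith
         have "\<gamma> \<notin> span T" if c3: "card T = 3"
        proof -
          obtain \<alpha> \<alpha>' where U12: "U1 = {\<alpha>}" "U2 = {\<alpha>'}"
            using eq[OF c3] by (metis card_1_singletonE)
          then have ne: "\<alpha> \<noteq> \<alpha>'" using eq[OF c3] by auto
          have "\<alpha> \<in> U1" "\<alpha>' \<in> U2" using U12 by auto
          then have *: "\<alpha> \<in> S" "\<alpha>' \<in> S" "medium \<gamma> \<beta> \<alpha>" "large \<gamma> \<beta> \<alpha>'"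
            using T unfolding U1_def U2_def by auto
          have "T = {\<beta>, \<alpha>, \<alpha>'}" using U U12 \<beta>(1) by auto
          then show ?thesis
            using medium_large_not_in_span[OF \<gamma> \<beta>S orth norm *(1,2) ne *(3,4)] by simp
        qed
        moreover have "card T \<le> 3"
          using c1 c2 c12 cardT unfolding U by linarith
        ultimately show ?thesis by blast
      qed
    qed
  qed
  ultimately show ?thesis by blast
qed

subsection \<open>Longest elements of parabolic subgroups\<close>

lemma linear_reflection: "linear (reflection \<alpha>)"
  unfolding reflection_def by (rule linearI) (simp_all add: inner_add_left algebra_simps add_divide_distrib)

lemma reflection_self: "\<alpha> \<in> \<Delta> \<Longrightarrow> reflection \<alpha> \<alpha> = - \<alpha>"
  unfolding reflection_def using root_norm_pos by (auto simp: scaleR_2)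

lemma reflection_reflection: "\<alpha> \<in> \<Delta> \<Longrightarrow> reflection \<alpha> (reflection \<alpha> x) = x"
  using root_norm_pos[of \<alpha>] unfolding reflection_def by (simp add: inner_diff_left algebra_simps flip: scaleR_left_distrib)

lemma inj_reflection: "\<alpha> \<in> \<Delta> \<Longrightarrow> inj (reflection \<alpha>)"
  using reflection_reflection by (metis injI)

lemma reflection_diff_span: "\<alpha> \<in> T \<Longrightarrow> reflection \<alpha> x - x \<in> span T"
  unfolding reflection_def by (simp add: span_neg span_mul span_base)

text \<open>\<gamma> has a positive coordinate at some simple root outside \<open>T\<close>, and
  \<delta> shares it.\<close>

lemma pos_shift:
  assumes "\<gamma> \<in> P" "\<gamma> \<notin> span T" "T \<subseteq> S" "\<delta> \<in> \<Delta>" "\<delta> - \<gamma> \<in> span T"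
  shows "\<delta> \<in> P"
  using assms(4)
proof (rule pos_cases)
  assume "- \<delta> \<in> P"
  moreover have "\<gamma> + - \<delta> \<in> span T" using span_neg[OF assms(5)] by simp
  ultimately show ?thesis using pos_summand_in_span assms(1,2,3) by blast
qed

lemma simple_in_span: "T \<subseteq> S \<Longrightarrow> \<alpha> \<in> S \<Longrightarrow> \<alpha> \<in> span T \<Longrightarrow> \<alpha> \<in> T"
  using independent_simple span_mono[of T "S - {\<alpha>}"] unfolding dependent_def by blast

text \<open>Reflections are involutions, so for a set \<open>T\<close> of roots this monoid is
  already the group they generate.\<close>

inductive_set weyl :: "'a set \<Rightarrow> ('a \<Rightarrow> 'a) set" for T where
  weyl_id: "id \<in> weyl T"
| weyl_reflection: "f \<in> weyl T \<Longrightarrow> \<alpha> \<in> T \<Longrightarrow> f \<circ> reflection \<alpha> \<in> weyl T"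

lemma weyl_props:
  assumes "f \<in> weyl T" "T \<subseteq> S"
  shows "linear f \<and> inj f \<and> f ` \<Delta> \<subseteq> \<Delta> \<and> (\<forall>x. f x - x \<in> span T)"
  using assms(1)
proof (induction rule: weyl.induct)
  case weyl_id
  then show ?case by (simp add: span_zero linear_id[unfolded id_def] id_def)
next
  case (weyl_reflection f \<alpha>)
  then have \<alpha>: "\<alpha> \<in> \<Delta>" using assms(2) simple_root by blast
  have "f (reflection \<alpha> x) - x \<in> span T" for x
    using span_add[of "f (reflection \<alpha> x) - reflection \<alpha> x" T "reflection \<alpha> x - x"] weyl_reflection reflection_diff_span by simp
  moreover have "(f \<circ> reflection \<alpha>) ` \<Delta> \<subseteq> \<Delta>"
    using weyl_reflection.IH reflection_root[OF \<alpha>] by auto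
  ultimately show ?case
    using weyl_reflection.IH linear_compose[OF linear_reflection] inj_compose[OF _ inj_reflection[OF \<alpha>]]
    unfolding comp_def by blast
qed

lemma span_shift: "y - x \<in> span T \<Longrightarrow> y \<in> span T \<longleftrightarrow> x \<in> span T"
  using span_add[of "y - x" T x] span_diff[of y T "y - x"] by auto

text \<open>
  An element of \<open>weyl T\<close> that makes as few as possible of the positive roots in the span of \<open>T\<close>
  positive is the longest element of the parabolic subgroup.
\<close>

lemma exists_all_negative:
  assumes T: "T \<subseteq> S"
  shows "\<exists>f\<in>weyl T. \<forall>\<alpha>\<in>T. - f \<alpha> \<in> P"
proof -
  define \<Phi> where "\<Phi> = {\<delta> \<in> P. \<delta> \<in> span T}"
  define N where "N f = card {\<delta> \<in> \<Phi>. f \<delta> \<in> P}" for f :: "'a \<Rightarrow> 'a"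
  have fin: "finite {\<delta> \<in> \<Phi>. f \<delta> \<in> P}" for f unfolding \<Phi>_def by simp
  obtain f where f: "f \<in> weyl T" and least: "\<And>g. g \<in> weyl T \<Longrightarrow> N f \<le> N g"
    using ex_has_least_nat[of "\<lambda>f. f \<in> weyl T" id N] weyl_id by blast
  note fp = weyl_props[OF f T]
  have "- f \<alpha> \<in> P" if \<alpha>: "\<alpha> \<in> T" for \<alpha>
  proof (rule ccontr)
    assume neg: "- f \<alpha> \<notin> P"
    have \<alpha>S: "\<alpha> \<in> S" and \<alpha>R: "\<alpha> \<in> \<Delta>" using \<alpha> T simple_root by auto
    have "f \<alpha> \<in> \<Delta>" using fp \<alpha>R by blast
    then have f\<alpha>: "f \<alpha> \<in> P" using neg pos_cases by blast
    let ?g = "f \<circ> reflection \<alpha>"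
    \<comment> \<open>The reflection in \<alpha> permutes the positive roots that are not multiples
      of \<alpha>, so \<open>?g\<close> makes fewer roots positive than \<open>f\<close>: at least
      \<alpha> is lost.\<close>
    have "reflection \<alpha> ` {\<delta> \<in> \<Phi>. ?g \<delta> \<in> P} \<subseteq> {\<delta> \<in> \<Phi>. f \<delta> \<in> P} - {\<alpha>}"
    proof
      fix \<epsilon> assume "\<epsilon> \<in> reflection \<alpha> ` {\<delta> \<in> \<Phi>. ?g \<delta> \<in> P}"
      then obtain \<delta> where \<delta>: "\<delta> \<in> \<Phi>" "f (reflection \<alpha> \<delta>) \<in> P" "\<epsilon> = reflection \<alpha> \<delta>" by auto
      have \<delta>P: "\<delta> \<in> P" "\<delta> \<in> span T" using \<delta>(1) unfolding \<Phi>_def by auto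
      \<comment> \<open>Positive multiples of \<alpha>, possibly including 2\<alpha>, do not
        interfere: \<open>?g\<close> makes them negative.\<close>
      have ns: "\<delta> \<notin> span {\<alpha>}"
      proof
        assume "\<delta> \<in> span {\<alpha>}"
        then obtain c where c: "\<delta> = c *\<^sub>R \<alpha>" by (auto simp: span_singleton)
        have "c > 0"
          using pos_inner[OF \<delta>P(1)] pos_inner[OF simple_pos[OF \<alpha>S]] unfolding c by (simp add: zero_less_mult_iff)
        have "f (reflection \<alpha> \<delta>) = - c *\<^sub>R f \<alpha>"
          unfolding c using fp reflection_self[OF \<alpha>R] linear_reflection[of \<alpha>] by (simp add: linear_scale linear_neg)
        then show False
          using pos_inner[OF \<delta>(2)] pos_inner[OF f\<alpha>] \<open>c > 0\<close> by (simp add: mult_less_0_iff)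
      qed
      have "\<epsilon> \<in> P"
        unfolding \<delta>(3)
        using pos_shift[OF \<delta>P(1) ns _ reflection_root[OF \<alpha>R pos_root[OF \<delta>P(1)]]] \<alpha>S reflection_diff_span by blast
      moreover have "\<epsilon> \<in> span T"
        unfolding \<delta>(3) using span_shift[OF reflection_diff_span[OF \<alpha>]] \<delta>P(2) by blast
      moreover have "\<epsilon> \<noteq> \<alpha>"
      proof
        assume "\<epsilon> = \<alpha>"
        then have "\<delta> = - \<alpha>" using \<delta>(3) reflection_reflection[OF \<alpha>R, of \<delta>] reflection_self[OF \<alpha>R] by simp
        then show False using \<delta>P(1) pos_not_neg simple_pos[OF \<alpha>S] by blast
      qed
      ultimately show "\<epsilon> \<in> {\<delta> \<in> \<Phi>. f \<delta> \<in> P} - {\<alpha>}"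
        using \<delta>(2,3) unfolding \<Phi>_def by blast
    qed
    moreover have "\<alpha> \<in> {\<delta> \<in> \<Phi>. f \<delta> \<in> P}"
      using f\<alpha> \<alpha> simple_pos[OF \<alpha>S] unfolding \<Phi>_def by (simp add: span_base)
    ultimately have "reflection \<alpha> ` {\<delta> \<in> \<Phi>. ?g \<delta> \<in> P} \<subset> {\<delta> \<in> \<Phi>. f \<delta> \<in> P}" by blast
    then have "card (reflection \<alpha> ` {\<delta> \<in> \<Phi>. ?g \<delta> \<in> P}) < N f"
      unfolding N_def by (rule psubset_card_mono[OF fin])
    moreover have "card (reflection \<alpha> ` {\<delta> \<in> \<Phi>. ?g \<delta> \<in> P}) = N ?g"
      unfolding N_def by (intro card_image inj_on_subset[OF inj_reflection[OF \<alpha>R]]) simp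
    ultimately show False using least[OF weyl_reflection[OF f \<alpha>]] by simp
  qed
  then show ?thesis using f by blast
qed

text \<open>The additive map \<open>- f\<close> sends the positive roots in the span of
  \<open>T\<close> injectively, hence bijectively, to themselves. A decomposition of
  \<open>- f \<alpha>\<close> would therefore pull back to one of \<alpha>; so
  \<open>- f \<alpha>\<close> is simple and, lying in the span, belongs to \<open>T\<close>.\<close>

lemma exists_opposition:
  assumes T: "T \<subseteq> S"
  obtains f where "linear f" "inj f" "f ` \<Delta> \<subseteq> \<Delta>" "\<And>x. f x - x \<in> span T" "(\<lambda>\<alpha>. - f \<alpha>) ` T = T"
proof -
  obtain f where f: "f \<in> weyl T" and neg: "\<And>\<alpha>. \<alpha> \<in> T \<Longrightarrow> - f \<alpha> \<in> P"
    using exists_all_negative[OF T] by blast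
  from weyl_props[OF f T] have lin: "linear f" and inj: "inj f" and root: "f ` \<Delta> \<subseteq> \<Delta>"
    and diff: "\<And>x. f x - x \<in> span T" by auto
  define \<Phi> where "\<Phi> = {\<delta> \<in> P. \<delta> \<in> span T}"
  have inj': "inj_on (\<lambda>\<delta>. - f \<delta>) A" for A using inj by (auto simp: inj_on_def)
  have span: "- f x \<in> span T \<longleftrightarrow> x \<in> span T" for x
    using span_shift[OF diff] span_neg[of "f x" T] span_neg[of "- f x" T] by auto
  have "(\<lambda>\<delta>. - f \<delta>) ` \<Phi> \<subseteq> \<Phi>"
  proof
    fix \<epsilon> assume "\<epsilon> \<in> (\<lambda>\<delta>. - f \<delta>) ` \<Phi>"
    then obtain \<delta> where \<delta>: "\<delta> \<in> P" "\<delta> \<in> span T" "\<epsilon> = - f \<delta>" unfolding \<Phi>_def by auto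
    obtain k :: "'a \<Rightarrow> nat" where k: "\<delta> = (\<Sum>\<alpha>\<in>T. real (k \<alpha>) *\<^sub>R \<alpha>)"
      using pos_span_combination[OF \<delta>(1,2) T] by blast
    have R: "\<epsilon> \<in> \<Delta>" using \<delta> root pos_root root_uminus by blast
    have "v \<bullet> \<epsilon> = (\<Sum>\<alpha>\<in>T. real (k \<alpha>) * (v \<bullet> (- f \<alpha>)))"
      unfolding \<delta>(3) by (subst k) (simp add: linear_sum[OF lin] linear_scale[OF lin] inner_sum_right sum_negf)
    also have "\<dots> \<ge> 0" using pos_inner[OF neg] by (intro sum_nonneg mult_nonneg_nonneg) (auto simp: less_imp_le)
    finally have "v \<bullet> \<epsilon> > 0" using regular[OF R] by simp
    then show "\<epsilon> \<in> \<Phi>" unfolding \<Phi>_def using posI[OF R] \<delta> span by simp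
  qed
  then have surj: "(\<lambda>\<delta>. - f \<delta>) ` \<Phi> = \<Phi>"
    using endo_inj_surj[of \<Phi> "\<lambda>\<delta>. - f \<delta>"] inj' unfolding \<Phi>_def by simp
  have "- f \<alpha> \<in> T" if \<alpha>: "\<alpha> \<in> T" for \<alpha>
  proof (rule simple_in_span[OF T])
    show sp: "- f \<alpha> \<in> span T" using span \<alpha> span_base by blast
    show "- f \<alpha> \<in> S"
    proof (rule ccontr)
      assume "- f \<alpha> \<notin> S"
      then obtain \<beta> \<gamma> where bg: "\<beta> \<in> P" "\<gamma> \<in> P" "- f \<alpha> = \<beta> + \<gamma>"
        using neg[OF \<alpha>] unfolding simple_roots_def by blast
      have "\<beta> \<in> \<Phi>" "\<gamma> \<in> \<Phi>"
        using pos_summand_in_span[OF bg(1,2) _ T] pos_summand_in_span[OF bg(2,1) _ T] bg sp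
        unfolding \<Phi>_def by (auto simp: add.commute)
      then have "\<beta> \<in> (\<lambda>\<delta>. - f \<delta>) ` \<Phi>" "\<gamma> \<in> (\<lambda>\<delta>. - f \<delta>) ` \<Phi>"
        unfolding surj by simp_all
      then obtain \<beta>' \<gamma>' where *: "\<beta>' \<in> \<Phi>" "\<gamma>' \<in> \<Phi>" "\<beta> = - f \<beta>'" "\<gamma> = - f \<gamma>'"
        by (elim imageE) simp
      then have "f \<alpha> = f (\<beta>' + \<gamma>')" using arg_cong[OF bg(3), of uminus] *(3,4) linear_add[OF lin] by simp
      then have "\<alpha> = \<beta>' + \<gamma>'" using inj by (simp add: inj_eq)
      then show False using simple_indecomposable * \<alpha> T unfolding \<Phi>_def by blast
    qed
  qed
  then have "(\<lambda>\<alpha>. - f \<alpha>) ` T = T"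
    using endo_inj_surj[of T "\<lambda>\<alpha>. - f \<alpha>"] inj' finite_subset[OF T finite_simple] by blast
  then show thesis using that lin inj root diff by blast
qed

text \<open>
  The longest element of the parabolic subgroup of \<open>T\<close> preserves positivity outside the span of \<open>T\<close>
  and maps \<open>T\<close> to \<open>- T\<close>, hence exchanges the two sets.
\<close>

lemma card_down_eq_card_up:
  assumes T: "T \<subseteq> S"
  shows "card {\<gamma> \<in> P. \<gamma> \<notin> span T \<and> (\<forall>\<alpha>\<in>T. \<gamma> - \<alpha> \<in> \<Delta>)} = card {\<gamma> \<in> P. \<gamma> \<notin> span T \<and> (\<forall>\<alpha>\<in>T. \<gamma> + \<alpha> \<in> \<Delta>)}"
    (is "card ?A = card ?B")
proof -
  obtain f where lin: "linear f" and inj: "inj f" and root: "f ` \<Delta> \<subseteq> \<Delta>"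
    and diff: "\<And>x. f x - x \<in> span T" and fT: "(\<lambda>\<alpha>. - f \<alpha>) ` T = T"
    using exists_opposition[OF T] by metis
  have pos: "f \<gamma> \<in> P" "f \<gamma> \<notin> span T" if "\<gamma> \<in> P" "\<gamma> \<notin> span T" for \<gamma>
    using pos_shift[OF that T _ diff] root pos_root[OF that(1)] span_shift[OF diff] that(2) by blast+
  have inj': "inj_on f X" for X using inj by (auto simp: inj_on_def)
  have "f ` ?A \<subseteq> ?B"
  proof (intro image_subsetI CollectI conjI ballI)
    fix \<gamma> \<beta> assume \<gamma>: "\<gamma> \<in> ?A" and "\<beta> \<in> T"
    then obtain \<alpha> where \<alpha>: "\<alpha> \<in> T" "\<beta> = - f \<alpha>" using fT by blast
    then have "f \<gamma> + \<beta> = f (\<gamma> - \<alpha>)" by (simp add: linear_diff[OF lin])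
    then show "f \<gamma> + \<beta> \<in> \<Delta>" using \<gamma> \<alpha> root by auto
  qed (use pos in auto)
  \<comment> \<open>Instead of inverting \<open>f\<close>, the same map is used backwards:
    injections both ways between finite sets suffice.\<close>
  moreover have "f ` ?B \<subseteq> ?A"
  proof (intro image_subsetI CollectI conjI ballI)
    fix \<gamma> \<beta> assume \<gamma>: "\<gamma> \<in> ?B" and "\<beta> \<in> T"
    then obtain \<alpha> where \<alpha>: "\<alpha> \<in> T" "\<beta> = - f \<alpha>" using fT by blast
    then have "f \<gamma> - \<beta> = f (\<gamma> + \<alpha>)" by (simp add: linear_add[OF lin])
    then show "f \<gamma> - \<beta> \<in> \<Delta>" using \<gamma> \<alpha> root by auto
  qed (use pos in auto)
  ultimately show ?thesis
    using card_inj_on_le[OF inj', of ?A ?B] card_inj_on_le[OF inj', of ?B ?A] by simp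
qed

subsection \<open>The highest root\<close>

lemma inner_span_zero:
  assumes "\<And>\<alpha> \<beta>. \<alpha> \<in> A \<Longrightarrow> \<beta> \<in> B \<Longrightarrow> \<alpha> \<bullet> \<beta> = 0" "x \<in> span A" "y \<in> span B"
  shows "x \<bullet> (y :: 'a) = 0"
proof -
  have "\<alpha> \<bullet> y = 0" if "\<alpha> \<in> A" for \<alpha>
    using assms(3) by (induction rule: span_induct_alt) (use assms(1) that in \<open>auto simp: inner_add_right\<close>)
  with assms(2) show ?thesis
    by (induction rule: span_induct_alt) (auto simp: inner_add_left)
qed

text \<open>The reflection in \<gamma> would take \<beta> + \<gamma> to \<beta> - \<gamma>, which
  has coordinates of both signs.\<close>

lemma no_orthogonal_sum:
  assumes J: "J \<subseteq> S" and orth: "\<And>\<alpha> \<beta>. \<alpha> \<in> J \<Longrightarrow> \<beta> \<in> S - J \<Longrightarrow> \<alpha> \<bullet> \<beta> = 0"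
    and \<beta>: "\<beta> \<in> P" "\<beta> \<in> span J" and \<gamma>: "\<gamma> \<in> P" "\<gamma> \<in> span (S - J)"
  shows "\<beta> + \<gamma> \<notin> P"
proof
  assume sum: "\<beta> + \<gamma> \<in> P"
  have disj: "\<not> (x \<in> span J \<and> x \<in> span (S - J))" if "x \<in> P" for x
    using inner_span_zero[of J "S - J" x x, OF orth] root_norm_pos[OF pos_root[OF that]] by auto
  have "\<beta> \<bullet> \<gamma> = 0" using inner_span_zero[OF orth \<beta>(2) \<gamma>(2)] .
  then have "reflection \<gamma> (\<beta> + \<gamma>) = \<beta> - \<gamma>"
    using root_norm_pos[OF pos_root[OF \<gamma>(1)]] unfolding reflection_def
    by (simp add: inner_add_left scaleR_2)
  then have "\<beta> - \<gamma> \<in> \<Delta>"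
    using reflection_root[OF pos_root[OF \<gamma>(1)] pos_root[OF sum]] by simp
  then show False
  proof (rule pos_cases)
    assume "\<beta> - \<gamma> \<in> P"
    then have "\<gamma> \<in> span J"
      using pos_summand_in_span[OF \<gamma>(1), of "\<beta> - \<gamma>" J] \<beta>(2) J by simp
    then show False using disj \<gamma> by blast
  next
    assume "- (\<beta> - \<gamma>) \<in> P"
    then have "\<beta> \<in> span (S - J)"
      using pos_summand_in_span[OF \<beta>(1), of "- (\<beta> - \<gamma>)" "S - J"] \<gamma>(2) by simp
    then show False using disj \<beta> by blast
  qed
qed

text \<open>Otherwise \<open>no_orthogonal_sum\<close> and induction over sums place every positive
  root in the span of \<open>J\<close> or of \<open>S - J\<close>, and \<Delta> splits
  orthogonally.\<close>

lemma simple_connected: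
  assumes irr: "irreducible_root_system \<Delta>" and J: "J \<subseteq> S" "J \<noteq> {}" "J \<noteq> S"
  shows "\<exists>\<alpha>\<in>J. \<exists>\<beta>\<in>S - J. \<alpha> \<bullet> \<beta> \<noteq> 0"
proof (rule ccontr)
  assume "\<not> ?thesis"
  then have orth: "\<And>\<alpha> \<beta>. \<alpha> \<in> J \<Longrightarrow> \<beta> \<in> S - J \<Longrightarrow> \<alpha> \<bullet> \<beta> = 0" by blast
  have split: "\<gamma> \<in> span J \<or> \<gamma> \<in> span (S - J)" if "\<gamma> \<in> P" for \<gamma>
    using that
  proof (induction rule: pos_induct)
    case (simple \<alpha>)
    then show ?case by (cases "\<alpha> \<in> J") (auto intro: span_base)
  next
    case (add \<beta> \<gamma>)
    have "\<not> (\<beta> \<in> span J \<and> \<gamma> \<in> span (S - J))" "\<not> (\<gamma> \<in> span J \<and> \<beta> \<in> span (S - J))"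
      using no_orthogonal_sum[OF J(1) orth] add.hyps by (metis add.commute)+
    then show ?case using add.IH span_add by blast
  qed
  have "\<Delta> = {\<gamma> \<in> \<Delta>. \<gamma> \<in> span J} \<union> {\<gamma> \<in> \<Delta>. \<gamma> \<in> span (S - J)}"
  proof -
    have "\<gamma> \<in> span J \<or> \<gamma> \<in> span (S - J)" if "\<gamma> \<in> \<Delta>" for \<gamma>
      using that
    proof (rule pos_cases)
      assume "- \<gamma> \<in> P"
      from split[OF this] show ?thesis using span_neg[of "- \<gamma>"] by auto
    qed (rule split)
    then show ?thesis by blast
  qed
  moreover have "{\<gamma> \<in> \<Delta>. \<gamma> \<in> span J} \<noteq> {}" "{\<gamma> \<in> \<Delta>. \<gamma> \<in> span (S - J)} \<noteq> {}"
  proof -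
    obtain \<alpha> \<beta> where "\<alpha> \<in> J" "\<beta> \<in> S - J" using J by blast
    then have "\<alpha> \<in> {\<gamma> \<in> \<Delta>. \<gamma> \<in> span J}" "\<beta> \<in> {\<gamma> \<in> \<Delta>. \<gamma> \<in> span (S - J)}"
      using J(1) simple_root by (auto intro: span_base)
    then show "{\<gamma> \<in> \<Delta>. \<gamma> \<in> span J} \<noteq> {}" "{\<gamma> \<in> \<Delta>. \<gamma> \<in> span (S - J)} \<noteq> {}"
      by (metis empty_iff)+
  qed
  moreover have "\<forall>x\<in>{\<gamma> \<in> \<Delta>. \<gamma> \<in> span J}. \<forall>y\<in>{\<gamma> \<in> \<Delta>. \<gamma> \<in> span (S - J)}. x \<bullet> y = 0"
    using inner_span_zero[of J "S - J", OF orth] by blast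
  ultimately have "\<exists>A B. A \<noteq> {} \<and> B \<noteq> {} \<and> \<Delta> = A \<union> B \<and> (\<forall>\<alpha>\<in>A. \<forall>\<beta>\<in>B. \<alpha> \<bullet> \<beta> = 0)"
    by (intro exI conjI)
  with irr show False
    unfolding irreducible_root_system_def by (elim conjE notE)
qed

text \<open>A dominant root involves every simple root: at a simple root outside its support but
  adjacent to it, supplied by \<open>simple_connected\<close>, its inner product would be negative.
  Hence \<open>\<theta> \<bullet> \<theta>'\<close> is a sum of nonnegative terms, one of them
  positive.\<close>

lemma dominant_inner_pos:
  assumes irr: "irreducible_root_system \<Delta>"
    and \<theta>: "\<theta> \<in> P" "\<And>\<alpha>. \<alpha> \<in> S \<Longrightarrow> \<theta> \<bullet> \<alpha> \<ge> 0"
    and \<theta>': "\<theta>' \<in> P" "\<And>\<alpha>. \<alpha> \<in> S \<Longrightarrow> \<theta>' \<bullet> \<alpha> \<ge> 0"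
  shows "\<theta> \<bullet> \<theta>' > 0"
proof -
  obtain k :: "'a \<Rightarrow> nat" where k: "\<theta> = (\<Sum>\<alpha>\<in>S. real (k \<alpha>) *\<^sub>R \<alpha>)"
    using pos_combination[OF \<theta>(1)] by blast
  define J where "J = {\<alpha> \<in> S. k \<alpha> > 0}"
  have J: "J \<subseteq> S" unfolding J_def by blast
  have "J = S"
  proof (rule ccontr)
    assume "J \<noteq> S"
    have "J \<noteq> {}"
    proof
      assume "J = {}"
      then have "\<theta> = 0" unfolding k J_def by (intro sum.neutral) auto
      then show False using \<theta>(1) pos_root zero_notin by blast
    qed
    then obtain \<alpha> \<beta> where ab: "\<alpha> \<in> J" "\<beta> \<in> S - J" "\<alpha> \<bullet> \<beta> \<noteq> 0"
      using simple_connected[OF irr _ _ \<open>J \<noteq> S\<close>] unfolding J_def by blast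
    have np: "real (k \<delta>) * (\<delta> \<bullet> \<beta>) \<le> 0" if "\<delta> \<in> S" for \<delta>
      using simple_nonpos[OF that, of \<beta>] ab(2) by (cases "\<delta> = \<beta>") (auto simp: J_def mult_le_0_iff)
    have "\<theta> \<bullet> \<beta> = (\<Sum>\<delta>\<in>S. real (k \<delta>) * (\<delta> \<bullet> \<beta>))"
      by (subst k) (simp add: inner_sum_left)
    moreover have "\<theta> \<bullet> \<beta> \<ge> 0" using \<theta>(2) ab(2) by blast
    moreover have "(\<Sum>\<delta>\<in>S. real (k \<delta>) * (\<delta> \<bullet> \<beta>)) \<le> 0" using np by (rule sum_nonpos)
    ultimately have "(\<Sum>\<delta>\<in>S. real (k \<delta>) * (\<delta> \<bullet> \<beta>)) = 0" by linarith
    then have "real (k \<alpha>) * (\<alpha> \<bullet> \<beta>) = 0"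
      using sum_nonneg_0[OF finite_simple, of "\<lambda>\<delta>. - (real (k \<delta>) * (\<delta> \<bullet> \<beta>))" \<alpha>] np ab(1) J
      unfolding sum_negf by force
    then show False using ab unfolding J_def by simp
  qed
  then have kpos: "k \<alpha> > 0" if "\<alpha> \<in> S" for \<alpha> using that unfolding J_def by blast
  have e: "\<theta> \<bullet> \<theta>' = (\<Sum>\<alpha>\<in>S. real (k \<alpha>) * (\<theta>' \<bullet> \<alpha>))"
    by (subst k) (simp add: inner_sum_left inner_commute[of \<theta>'])
  obtain \<alpha> where \<alpha>: "\<alpha> \<in> S" "\<theta>' \<bullet> \<alpha> > 0" using pos_acute_simple[OF \<theta>'(1)] .
  show ?thesis unfolding e
  proof (rule sum_pos2[OF finite_simple \<alpha>(1)])
    show "0 < real (k \<alpha>) * (\<theta>' \<bullet> \<alpha>)" using kpos \<alpha> by simp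
  qed (use \<theta>'(2) in simp)
qed

text \<open>Shrink \<delta> by a simple \<alpha> with
  \<open>\<delta> \<bullet> \<alpha> > 0\<close>; by dominance \<theta> + \<delta> also pairs
  positively with \<alpha>, so both differences are roots. Thus a root that is maximal for simple
  steps admits no positive summand at all.\<close>

lemma dominant_ladder:
  assumes \<theta>: "\<theta> \<in> P" "\<And>\<alpha>. \<alpha> \<in> S \<Longrightarrow> \<theta> \<bullet> \<alpha> \<ge> 0" and "\<delta> \<in> P" "\<theta> + \<delta> \<in> \<Delta>"
  shows "\<exists>\<alpha>\<in>S. \<theta> + \<alpha> \<in> \<Delta>"
  using assms(3,4)
proof (induction "card {\<epsilon> \<in> P. v \<bullet> \<epsilon> < v \<bullet> \<delta>}" arbitrary: \<delta> rule: less_induct)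
  case less
  obtain \<alpha> where \<alpha>: "\<alpha> \<in> S" "\<delta> \<bullet> \<alpha> > 0" using pos_acute_simple[OF less.prems(1)] .
  show ?case
  proof (cases "\<delta> = \<alpha>")
    case True
    then show ?thesis using less.prems(2) \<alpha>(1) by blast
  next
    case False
    then have \<delta>': "\<delta> - \<alpha> \<in> P"
      using pos_diff_simple[OF less.prems(1) \<alpha>(1)] root_diff[OF pos_root[OF less.prems(1)] simple_root[OF \<alpha>(1)]] \<alpha>(2)
      by simp
    have "(\<theta> + \<delta>) \<bullet> \<alpha> > 0" using \<theta>(2)[OF \<alpha>(1)] \<alpha>(2) by (simp add: inner_add_left)
    moreover have "\<theta> + \<delta> \<noteq> \<alpha>" using simple_indecomposable[OF \<alpha>(1) \<theta>(1) less.prems(1)] by metis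
    ultimately have "\<theta> + (\<delta> - \<alpha>) \<in> \<Delta>"
      using root_diff[OF less.prems(2) simple_root[OF \<alpha>(1)]] by (simp add: algebra_simps)
    moreover have "card {\<epsilon> \<in> P. v \<bullet> \<epsilon> < v \<bullet> (\<delta> - \<alpha>)} < card {\<epsilon> \<in> P. v \<bullet> \<epsilon> < v \<bullet> \<delta>}"
    proof (rule psubset_card_mono)
      have lt: "v \<bullet> (\<delta> - \<alpha>) < v \<bullet> \<delta>"
        using pos_inner[OF simple_pos[OF \<alpha>(1)]] by (simp add: inner_diff_right)
      then have "\<delta> - \<alpha> \<in> {\<epsilon> \<in> P. v \<bullet> \<epsilon> < v \<bullet> \<delta>} - {\<epsilon> \<in> P. v \<bullet> \<epsilon> < v \<bullet> (\<delta> - \<alpha>)}"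
        using \<delta>' by simp
      moreover have "{\<epsilon> \<in> P. v \<bullet> \<epsilon> < v \<bullet> (\<delta> - \<alpha>)} \<subseteq> {\<epsilon> \<in> P. v \<bullet> \<epsilon> < v \<bullet> \<delta>}"
        using lt by auto
      ultimately show "{\<epsilon> \<in> P. v \<bullet> \<epsilon> < v \<bullet> (\<delta> - \<alpha>)} \<subset> {\<epsilon> \<in> P. v \<bullet> \<epsilon> < v \<bullet> \<delta>}" by blast
    qed simp
    ultimately show ?thesis using less.hyps \<delta>' by blast
  qed
qed

lemma maximal_dominant:
  assumes "\<theta> \<in> P" "\<And>\<alpha>. \<alpha> \<in> S \<Longrightarrow> \<theta> + \<alpha> \<notin> \<Delta>" "\<alpha> \<in> S"
  shows "\<theta> \<bullet> \<alpha> \<ge> 0"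
proof (rule ccontr)
  assume "\<not> ?thesis"
  moreover have "\<theta> \<noteq> - \<alpha>" using pos_not_neg[OF simple_pos[OF assms(3)]] assms(1) by blast
  ultimately have "\<theta> + \<alpha> \<in> \<Delta>"
    using root_add[OF pos_root[OF assms(1)] simple_root[OF assms(3)]] by simp
  then show False using assms by blast
qed

text \<open>Both roots are dominant, so they pair positively and differ by a root;
  \<open>dominant_ladder\<close> then contradicts the maximality of the lower one.\<close>

lemma maximal_unique:
  assumes irr: "irreducible_root_system \<Delta>"
    and \<theta>: "\<theta> \<in> P" "\<And>\<alpha>. \<alpha> \<in> S \<Longrightarrow> \<theta> + \<alpha> \<notin> \<Delta>"
    and \<theta>': "\<theta>' \<in> P" "\<And>\<alpha>. \<alpha> \<in> S \<Longrightarrow> \<theta>' + \<alpha> \<notin> \<Delta>"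
  shows "\<theta> = \<theta>'"
proof (rule ccontr)
  assume "\<theta> \<noteq> \<theta>'"
  have "\<theta> \<bullet> \<theta>' > 0"
    using dominant_inner_pos[OF irr \<theta>(1) _ \<theta>'(1)] maximal_dominant \<theta> \<theta>' by blast
  then have "\<theta> - \<theta>' \<in> \<Delta>" using root_diff pos_root \<theta> \<theta>' \<open>\<theta> \<noteq> \<theta>'\<close> by blast
  then show False
  proof (rule pos_cases)
    assume "\<theta> - \<theta>' \<in> P"
    then show False
      using dominant_ladder[OF \<theta>'(1) maximal_dominant[OF \<theta>'], of "\<theta> - \<theta>'"] \<theta> \<theta>' pos_root by auto
  next
    assume "- (\<theta> - \<theta>') \<in> P"
    then show False
      using dominant_ladder[OF \<theta>(1) maximal_dominant[OF \<theta>], of "- (\<theta> - \<theta>')"] \<theta> \<theta>' pos_root by auto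
  qed
qed

lemma card_maximal:
  assumes irr: "irreducible_root_system \<Delta>"
  shows "card {\<gamma> \<in> P. \<forall>\<alpha>\<in>S. \<gamma> + \<alpha> \<notin> \<Delta>} = 1" (is "card ?M = 1")
proof -
  obtain \<alpha> where "\<alpha> \<in> \<Delta>" using irr unfolding irreducible_root_system_def by blast
  then have "P \<noteq> {}" using pos_cases by blast
  define m where "m = Max ((\<bullet>) v ` P)"
  have "m \<in> (\<bullet>) v ` P" unfolding m_def using \<open>P \<noteq> {}\<close> by (intro Max_in) auto
  then obtain \<theta> where \<theta>: "\<theta> \<in> P" "v \<bullet> \<theta> = m" by auto
  have max: "v \<bullet> \<gamma> \<le> m" if "\<gamma> \<in> P" for \<gamma> unfolding m_def using that by (intro Max_ge) auto
  have "\<theta> + \<alpha> \<notin> \<Delta>" if "\<alpha> \<in> S" for \<alpha>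
  proof
    assume "\<theta> + \<alpha> \<in> \<Delta>"
    then have "\<theta> + \<alpha> \<in> P" using pos_add[OF \<theta>(1) simple_pos[OF that]] by blast
    from max[OF this] show False using \<theta>(2) pos_inner[OF simple_pos[OF that]] by (simp add: inner_add_right)
  qed
  then have "?M = {\<theta>}" using maximal_unique[OF irr] \<theta>(1) by blast
  then show ?thesis by simp
qed

subsection \<open>The covering polynomials\<close>

definition down :: "'a \<Rightarrow> 'a set" where "down \<gamma> = {\<alpha> \<in> S. \<gamma> - \<alpha> \<in> \<Delta>}"
definition up :: "'a \<Rightarrow> 'a set" where "up \<gamma> = {\<alpha> \<in> S. \<gamma> + \<alpha> \<in> \<Delta>}"

abbreviation le :: "'a rel" where "le \<equiv> root_order P"

lemma down_subset: "down \<gamma> \<subseteq> S" and up_subset: "up \<gamma> \<subseteq> S"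
  unfolding down_def up_def by auto

lemma kappa_eq:
  assumes "\<gamma> \<in> P"
  shows "kappa P le \<gamma> = card (down \<gamma>)"
proof -
  have "{y \<in> P. covers P le \<gamma> y} = (\<lambda>\<alpha>. \<gamma> - \<alpha>) ` down \<gamma>"
  proof (intro equalityI subsetI)
    fix y assume "y \<in> {y \<in> P. covers P le \<gamma> y}"
    then have "y \<in> P" "\<gamma> - y \<in> S" using covers_root_order_iff[OF rs positive_roots] by auto
    then have "y = \<gamma> - (\<gamma> - y)" "\<gamma> - y \<in> down \<gamma>"
      using pos_root unfolding down_def by auto
    then show "y \<in> (\<lambda>\<alpha>. \<gamma> - \<alpha>) ` down \<gamma>" by (rule image_eqI)
  next
    fix y assume "y \<in> (\<lambda>\<alpha>. \<gamma> - \<alpha>) ` down \<gamma>"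
    then show "y \<in> {y \<in> P. covers P le \<gamma> y}"
      using assms pos_diff_simple[OF assms] covers_root_order_iff[OF rs positive_roots]
      unfolding down_def by auto
  qed
  then show ?thesis unfolding kappa_def by (simp add: card_image inj_on_def)
qed

lemma iota_eq:
  assumes "\<gamma> \<in> P"
  shows "iota P le \<gamma> = card (up \<gamma>)"
proof -
  have "{y \<in> P. covers P le y \<gamma>} = (\<lambda>\<alpha>. \<gamma> + \<alpha>) ` up \<gamma>"
  proof (intro equalityI subsetI)
    fix y assume "y \<in> {y \<in> P. covers P le y \<gamma>}"
    then have "y \<in> P" "y - \<gamma> \<in> S" using covers_root_order_iff[OF rs positive_roots] by auto
    then have "y = \<gamma> + (y - \<gamma>)" "y - \<gamma> \<in> up \<gamma>"
      using pos_root unfolding up_def by auto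
    then show "y \<in> (\<lambda>\<alpha>. \<gamma> + \<alpha>) ` up \<gamma>" by (rule image_eqI)
  next
    fix y assume "y \<in> (\<lambda>\<alpha>. \<gamma> + \<alpha>) ` up \<gamma>"
    then show "y \<in> {y \<in> P. covers P le y \<gamma>}"
      using assms pos_add[OF assms] simple_pos covers_root_order_iff[OF rs positive_roots]
      unfolding up_def by auto
  qed
  then show ?thesis unfolding iota_def by (simp add: card_image inj_on_def)
qed

lemma coeff_sum_monom: "coeff (\<Sum>x\<in>A. monom (1::int) (h x)) i = int (card {x \<in> A. h x = i})" if "finite A"
  using that by (simp add: coeff_sum Int_def flip: sum.inter_filter)

lemma coeff_upper: "coeff (upper_poly P le) i = int (card {\<gamma> \<in> P. card (down \<gamma>) = i})"
  unfolding upper_poly_def using kappa_eq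
  by (simp add: coeff_sum_monom cong: conj_cong)

lemma coeff_lower: "coeff (lower_poly P le) i = int (card {\<gamma> \<in> P. card (up \<gamma>) = i})"
  unfolding lower_poly_def using iota_eq
  by (simp add: coeff_sum_monom cong: conj_cong)

lemma down_card:
  assumes "\<gamma> \<in> \<Delta>" "T \<subseteq> down \<gamma>"
  shows "card T \<le> 3 \<and> (card T = 3 \<longrightarrow> \<gamma> \<notin> span T)"
  using simple_down_set[OF assms(1), of T] assms(2) unfolding down_def by blast

lemma up_eq_down_uminus: "up \<gamma> = down (- \<gamma>)"
proof -
  have "\<gamma> + \<alpha> \<in> \<Delta> \<longleftrightarrow> - \<gamma> - \<alpha> \<in> \<Delta>" for \<alpha>
    using root_uminus_iff[of "\<gamma> + \<alpha>"] by simp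
  then show ?thesis unfolding up_def down_def by simp
qed

lemma up_card:
  assumes "\<gamma> \<in> \<Delta>" "T \<subseteq> up \<gamma>"
  shows "card T \<le> 3 \<and> (card T = 3 \<longrightarrow> \<gamma> \<notin> span T)"
  using down_card[OF root_uminus[OF assms(1)], of T] assms(2) unfolding up_eq_down_uminus
  by (auto dest: span_neg)

text \<open>As \<open>k\<close> bounds the sizes, a \<open>k\<close>-element subset of
  \<open>D \<gamma>\<close> is all of it. Counting by subsets fixes \<open>T\<close>, as the
  exchange by its longest element requires.\<close>

lemma card_eq_sum_subsets:
  assumes "\<And>\<gamma>. \<gamma> \<in> P \<Longrightarrow> D \<gamma> \<subseteq> S" "\<And>\<gamma>. \<gamma> \<in> P \<Longrightarrow> card (D \<gamma>) \<le> k"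
  shows "card {\<gamma> \<in> P. card (D \<gamma>) = k} = (\<Sum>T | T \<subseteq> S \<and> card T = k. card {\<gamma> \<in> P. T \<subseteq> D \<gamma>})"
proof -
  have eq: "T = D \<gamma>" if "\<gamma> \<in> P" "card T = k" "T \<subseteq> D \<gamma>" for T \<gamma>
    using card_subset_eq[of "D \<gamma>" T] that assms[OF that(1)] card_mono[of "D \<gamma>" T]
      finite_subset[OF _ finite_simple] by fastforce
  have "{\<gamma> \<in> P. card (D \<gamma>) = k} = (\<Union>T\<in>{T. T \<subseteq> S \<and> card T = k}. {\<gamma> \<in> P. T \<subseteq> D \<gamma>})"
    using assms(1) eq by blast
  also have "card \<dots> = (\<Sum>T | T \<subseteq> S \<and> card T = k. card {\<gamma> \<in> P. T \<subseteq> D \<gamma>})"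
  proof (rule card_UN_disjoint)
    show "\<forall>T\<in>{T. T \<subseteq> S \<and> card T = k}. \<forall>U\<in>{T. T \<subseteq> S \<and> card T = k}. T \<noteq> U \<longrightarrow>
        {\<gamma> \<in> P. T \<subseteq> D \<gamma>} \<inter> {\<gamma> \<in> P. U \<subseteq> D \<gamma>} = {}"
      using eq by blast
  qed auto
  finally show ?thesis .
qed

lemma coeff_3_eq: "coeff (upper_poly P le) 3 = coeff (lower_poly P le) 3"
proof -
  have "card {\<gamma> \<in> P. T \<subseteq> down \<gamma>} = card {\<gamma> \<in> P. T \<subseteq> up \<gamma>}" if T: "T \<subseteq> S" "card T = 3" for T
  proof -
    \<comment> \<open>The span condition comes for free: \<open>down_card\<close> gives it for
      three-element sets.\<close>
    have "{\<gamma> \<in> P. T \<subseteq> down \<gamma>} = {\<gamma> \<in> P. \<gamma> \<notin> span T \<and> (\<forall>\<alpha>\<in>T. \<gamma> - \<alpha> \<in> \<Delta>)}"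
      using down_card pos_root T unfolding down_def by blast
    moreover have "{\<gamma> \<in> P. T \<subseteq> up \<gamma>} = {\<gamma> \<in> P. \<gamma> \<notin> span T \<and> (\<forall>\<alpha>\<in>T. \<gamma> + \<alpha> \<in> \<Delta>)}"
      using up_card pos_root T unfolding up_def by blast
    ultimately show ?thesis using card_down_eq_card_up[OF T(1)] by simp
  qed
  moreover have "card (down \<gamma>) \<le> 3" "card (up \<gamma>) \<le> 3" if "\<gamma> \<in> P" for \<gamma>
    using down_card[OF pos_root[OF that] subset_refl] up_card[OF pos_root[OF that] subset_refl] by auto
  ultimately show ?thesis
    unfolding coeff_upper coeff_lower
    using card_eq_sum_subsets[of down 3] card_eq_sum_subsets[of up 3] down_subset up_subset by simp
qed

lemma degree_upper: "degree (upper_poly P le) \<le> 3" and degree_lower: "degree (lower_poly P le) \<le> 3"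
proof -
  have "{\<gamma> \<in> P. card (down \<gamma>) = i} = {}" "{\<gamma> \<in> P. card (up \<gamma>) = i} = {}" if "i > 3" for i
    using that down_card[OF _ subset_refl] up_card[OF _ subset_refl] pos_root by force+
  then show "degree (upper_poly P le) \<le> 3" "degree (lower_poly P le) \<le> 3"
    by (intro degree_le allI impI; simp add: coeff_upper coeff_lower)+
qed

lemma down_empty_iff:
  assumes "\<gamma> \<in> P"
  shows "down \<gamma> = {} \<longleftrightarrow> \<gamma> \<in> S"
proof
  show "down \<gamma> = {}" if "\<gamma> \<in> S"
    using simple_diff_not_root[OF that] unfolding down_def by blast
  show "\<gamma> \<in> S" if "down \<gamma> = {}"
  proof (rule ccontr)
    assume "\<gamma> \<notin> S"
    obtain \<alpha> where "\<alpha> \<in> S" "\<gamma> \<bullet> \<alpha> > 0" using pos_acute_simple[OF assms] .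
    then have "\<alpha> \<in> down \<gamma>"
      using root_diff[OF pos_root[OF assms] simple_root] \<open>\<gamma> \<notin> S\<close> unfolding down_def by blast
    then show False using that by blast
  qed
qed

lemma coeff_upper_0: "coeff (upper_poly P le) 0 = int DIM('a)"
proof -
  have "{\<gamma> \<in> P. card (down \<gamma>) = 0} = S"
    using down_empty_iff simple_pos finite_subset[OF down_subset finite_simple] by auto
  then show ?thesis unfolding coeff_upper card_simple[symmetric] by simp
qed

lemma coeff_lower_0:
  assumes "irreducible_root_system \<Delta>"
  shows "coeff (lower_poly P le) 0 = 1"
proof -
  have "{\<gamma> \<in> P. card (up \<gamma>) = 0} = {\<gamma> \<in> P. \<forall>\<alpha>\<in>S. \<gamma> + \<alpha> \<notin> \<Delta>}"
    using finite_subset[OF up_subset finite_simple] by (auto simp: up_def)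
  then show ?thesis unfolding coeff_lower using card_maximal[OF assms] by simp
qed

lemma deviation_poly_root_order:
  assumes "irreducible_root_system \<Delta>"
  shows "deviation_poly P le = [:int DIM('a) - 1:]"
proof -
  define D where "D = deviation_poly P le"
  have e: "upper_poly P le - lower_poly P le = [:-1, 1:] ^ 2 * D"
    unfolding D_def by (rule deviation_poly_eq) simp
  have "coeff (upper_poly P le - lower_poly P le) i = 0" if "i > 2" for i
  proof (cases "i = 3")
    case True
    then show ?thesis using coeff_3_eq by simp
  next
    case False
    then show ?thesis
      using that degree_upper degree_lower by (simp add: coeff_eq_0)
  qed
  then have deg: "degree ([:-1, 1:] ^ 2 * D) \<le> 2" unfolding e[symmetric] by (intro degree_le) blast
  have "degree D = 0"
  proof (cases "D = 0")
    case False
    then have "degree ([:-1, 1:] ^ 2 * D) = 2 + degree D"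
      by (simp add: degree_mult_eq degree_power_eq)
    then show ?thesis using deg by simp
  qed simp
  then obtain d where d: "D = [:d:]" by (rule degree_eq_zeroE)
  \<comment> \<open>(q - 1)^2 has constant term 1, so \<open>d\<close> is the difference of the
    constant terms of the two polynomials.\<close>
  have "coeff ([:-1, 1:] ^ 2 * D) 0 = d" unfolding d by (simp add: power2_eq_square)
  then have "d = int DIM('a) - 1"
    unfolding e[symmetric] using coeff_upper_0 coeff_lower_0[OF assms] by simp
  then show ?thesis using d unfolding D_def by simp
qed

subsection \<open>Edges of the Hasse diagram in the simply-laced case\<close>

lemma sum_uminus_roots: "(\<Sum>\<gamma>\<in>\<Delta>. h (- \<gamma>)) = (\<Sum>\<gamma>\<in>\<Delta>. h \<gamma>)"
  by (rule sum.reindex_bij_witness[of _ uminus uminus]) (auto simp: root_uminus_iff)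

lemma inner_reflection: "\<alpha> \<in> \<Delta> \<Longrightarrow> reflection \<alpha> x \<bullet> y = x \<bullet> reflection \<alpha> y"
  unfolding reflection_def by (simp add: inner_diff inner_commute)

definition casimir :: "'a \<Rightarrow> 'a" where
  "casimir x = (\<Sum>\<gamma>\<in>\<Delta>. (\<gamma> \<bullet> x) *\<^sub>R \<gamma>)"

text \<open>The operator \<open>casimir\<close> commutes with the reflection in \<open>\<alpha>\<close>, whose \<open>-1\<close>-eigenspace is the line
  through \<open>\<alpha>\<close>.\<close>

lemma casimir_root:
  assumes "\<alpha> \<in> \<Delta>"
  shows "casimir \<alpha> = ((casimir \<alpha> \<bullet> \<alpha>) / (\<alpha> \<bullet> \<alpha>)) *\<^sub>R \<alpha>"
proof -
  have "reflection \<alpha> (casimir \<alpha>) = (\<Sum>\<gamma>\<in>\<Delta>. (\<gamma> \<bullet> \<alpha>) *\<^sub>R reflection \<alpha> \<gamma>)"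
    unfolding casimir_def using linear_reflection by (simp add: linear_sum linear_scale)
  also have "\<dots> = (\<Sum>\<gamma>\<in>\<Delta>. (reflection \<alpha> \<gamma> \<bullet> \<alpha>) *\<^sub>R \<gamma>)"
    by (rule sum.reindex_bij_witness[of _ "reflection \<alpha>" "reflection \<alpha>"])
      (use assms in \<open>auto simp: reflection_reflection reflection_root\<close>)
  also have "\<dots> = - casimir \<alpha>"
    unfolding casimir_def inner_reflection[OF assms] reflection_self[OF assms] by (simp add: sum_negf)
  finally have "casimir \<alpha> - (2 * (casimir \<alpha> \<bullet> \<alpha>) / (\<alpha> \<bullet> \<alpha>)) *\<^sub>R \<alpha> = - casimir \<alpha>"
    unfolding reflection_def .
  then have "2 *\<^sub>R casimir \<alpha> = (2 * (casimir \<alpha> \<bullet> \<alpha>) / (\<alpha> \<bullet> \<alpha>)) *\<^sub>R \<alpha>"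
    by (simp add: algebra_simps scaleR_2)
  from arg_cong[OF this, of "\<lambda>x. (1 / 2) *\<^sub>R x"] show ?thesis by simp
qed

text \<open>The trace of \<open>casimir\<close> in two ways: its summand for \<gamma> has rank one
  and trace \<open>\<gamma> \<bullet> \<gamma>\<close>, while in the basis \<open>S\<close> the
  operator is diagonal by \<open>casimir_root\<close>.\<close>

lemma sum_norm_eq_casimir:
  "(\<Sum>\<gamma>\<in>\<Delta>. \<gamma> \<bullet> \<gamma>) = (\<Sum>\<alpha>\<in>S. (casimir \<alpha> \<bullet> \<alpha>) / (\<alpha> \<bullet> \<alpha>))"
proof -
  let ?r = "representation S"
  have span: "x \<in> span S" for x using span_simple by simp
  have r: "(\<Sum>\<alpha>\<in>S. ?r x \<alpha> *\<^sub>R \<alpha>) = x" for x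
    using sum_representation_eq[OF independent_simple span finite_simple subset_refl] .
  have "\<gamma> \<bullet> \<gamma> = (\<Sum>\<alpha>\<in>S. (\<gamma> \<bullet> \<alpha>) * ?r \<gamma> \<alpha>)" for \<gamma>
  proof -
    have "\<gamma> \<bullet> \<gamma> = \<gamma> \<bullet> (\<Sum>\<alpha>\<in>S. ?r \<gamma> \<alpha> *\<^sub>R \<alpha>)" by (simp only: r)
    then show ?thesis by (simp add: inner_sum_right mult.commute)
  qed
  then have "(\<Sum>\<gamma>\<in>\<Delta>. \<gamma> \<bullet> \<gamma>) = (\<Sum>\<gamma>\<in>\<Delta>. \<Sum>\<alpha>\<in>S. (\<gamma> \<bullet> \<alpha>) * ?r \<gamma> \<alpha>)" by simp
  also have "\<dots> = (\<Sum>\<alpha>\<in>S. \<Sum>\<gamma>\<in>\<Delta>. (\<gamma> \<bullet> \<alpha>) * ?r \<gamma> \<alpha>)" by (rule sum.swap)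
  also have "\<dots> = (\<Sum>\<alpha>\<in>S. (casimir \<alpha> \<bullet> \<alpha>) / (\<alpha> \<bullet> \<alpha>))"
  proof (rule sum.cong[OF HOL.refl])
    fix \<alpha> assume \<alpha>: "\<alpha> \<in> S"
    have "(\<Sum>\<gamma>\<in>\<Delta>. (\<gamma> \<bullet> \<alpha>) * ?r \<gamma> \<alpha>) = ?r (casimir \<alpha>) \<alpha>"
      unfolding casimir_def
      by (simp add: representation_sum representation_scale independent_simple span)
    also have "\<dots> = ?r (((casimir \<alpha> \<bullet> \<alpha>) / (\<alpha> \<bullet> \<alpha>)) *\<^sub>R \<alpha>) \<alpha>"
      using casimir_root[OF simple_root[OF \<alpha>]] by simp
    also have "\<dots> = (casimir \<alpha> \<bullet> \<alpha>) / (\<alpha> \<bullet> \<alpha>)"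
      by (simp add: representation_scale representation_basis independent_simple span \<alpha>)
    finally show "(\<Sum>\<gamma>\<in>\<Delta>. (\<gamma> \<bullet> \<alpha>) * ?r \<gamma> \<alpha>) = (casimir \<alpha> \<bullet> \<alpha>) / (\<alpha> \<bullet> \<alpha>)" .
  qed
  finally show ?thesis .
qed

text \<open>In terms of the Cartan integer \<open>k\<close>, between -2 and 2, the left side is
  \<open>k\<^sup>2 * N\<^sup>2\<close>. Equal lengths make \<gamma> - \<alpha> a root exactly for
  \<open>k = 1\<close> and \<gamma> = \<alpha> exactly for \<open>k = 2\<close>; negative values are
  read off from -\<gamma>.\<close>

lemma simply_laced_inner:
  assumes sl: "simply_laced \<Delta>" and \<alpha>: "\<alpha> \<in> \<Delta>" and \<gamma>: "\<gamma> \<in> \<Delta>"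
  shows "4 * (\<gamma> \<bullet> \<alpha>)\<^sup>2 = (\<alpha> \<bullet> \<alpha>)\<^sup>2 *
    (of_bool (\<gamma> - \<alpha> \<in> \<Delta>) + of_bool (- \<gamma> - \<alpha> \<in> \<Delta>) + 4 * of_bool (\<gamma> = \<alpha>) + 4 * of_bool (- \<gamma> = \<alpha>))"
proof -
  define N where "N = \<alpha> \<bullet> \<alpha>"
  have N: "N > 0" unfolding N_def using root_norm_pos[OF \<alpha>] .
  have norm: "\<delta> \<bullet> \<delta> = N" if "\<delta> \<in> \<Delta>" for \<delta>
    using sl \<alpha> that unfolding simply_laced_def N_def by (metis norm_eq)
  have iff: "\<delta> - \<alpha> \<in> \<Delta> \<longleftrightarrow> 2 * (\<delta> \<bullet> \<alpha>) = N" if "\<delta> \<in> \<Delta>" for \<delta>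
  proof
    have e: "(\<delta> - \<alpha>) \<bullet> (\<delta> - \<alpha>) = 2 * N - 2 * (\<delta> \<bullet> \<alpha>)"
      using norm[OF that] N_def by (simp add: inner_diff inner_commute)
    show "2 * (\<delta> \<bullet> \<alpha>) = N" if "\<delta> - \<alpha> \<in> \<Delta>" using norm[OF that] e by simp
    show "\<delta> - \<alpha> \<in> \<Delta>" if "2 * (\<delta> \<bullet> \<alpha>) = N"
      using root_diff[OF \<open>\<delta> \<in> \<Delta>\<close> \<alpha>] that N N_def by force
  qed
  have eq_iff: "\<delta> = \<alpha> \<longleftrightarrow> \<delta> \<bullet> \<alpha> = N" if "\<delta> \<in> \<Delta>" for \<delta>
  proof
    assume "\<delta> \<bullet> \<alpha> = N"
    then have "(\<delta> - \<alpha>) \<bullet> (\<delta> - \<alpha>) \<le> 0"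
      using norm[OF that] N_def by (simp add: inner_diff inner_commute)
    then show "\<delta> = \<alpha>" using inner_self_nonpos by fastforce
  qed (simp add: N_def)
  obtain k :: int where k: "2 * (\<gamma> \<bullet> \<alpha>) = of_int k * N"
    using cartan_obtain[OF \<alpha> \<gamma>] unfolding N_def by blast
  have "(\<gamma> - \<alpha>) \<bullet> (\<gamma> - \<alpha>) = (2 - of_int k) * N" "(\<gamma> + \<alpha>) \<bullet> (\<gamma> + \<alpha>) = (2 + of_int k) * N"
    using norm[OF \<gamma>] N_def k by (simp_all add: inner_diff inner_add inner_commute algebra_simps)
  then have "(2 - of_int k) * N \<ge> 0" "(2 + of_int k) * N \<ge> 0" by (metis inner_ge_zero)+
  then have "k \<le> 2" "k \<ge> - 2" using N by (auto simp: zero_le_mult_iff)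
  then have cases: "k = - 2 \<or> k = - 1 \<or> k = 0 \<or> k = 1 \<or> k = 2" by linarith
  have g: "\<gamma> \<bullet> \<alpha> = of_int k * N / 2" using k by simp
  show ?thesis
    unfolding iff[OF \<gamma>] iff[OF root_uminus[OF \<gamma>]] eq_iff[OF \<gamma>] eq_iff[OF root_uminus[OF \<gamma>]]
      N_def[symmetric] inner_minus_left g
    using cases N by (elim disjE) (auto simp: power2_eq_square)
qed

text \<open>Sum \<open>simply_laced_inner\<close> over \<Delta>. Negation pairs the terms, and
  \<gamma> \<mapsto> \<alpha> - \<gamma> exchanges the positive and negative members of
  \<open>?D\<close>, reducing the count to \<open>P\<close>.\<close>

lemma simply_laced_casimir:
  assumes sl: "simply_laced \<Delta>" and \<alpha>: "\<alpha> \<in> S"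
  shows "casimir \<alpha> \<bullet> \<alpha> = (\<alpha> \<bullet> \<alpha>)\<^sup>2 * (2 + real (card {\<gamma> \<in> P. \<gamma> - \<alpha> \<in> \<Delta>}))"
proof -
  note \<alpha>R = simple_root[OF \<alpha>]
  let ?D = "{\<gamma> \<in> \<Delta>. \<gamma> - \<alpha> \<in> \<Delta>}" and ?E = "{\<gamma> \<in> P. \<gamma> - \<alpha> \<in> \<Delta>}"
  have sumD: "(\<Sum>\<gamma>\<in>\<Delta>. of_bool (\<gamma> - \<alpha> \<in> \<Delta>)) = real (card ?D)"
    by (simp add: of_bool_def Int_def flip: sum.inter_filter)
  have sum\<alpha>: "(\<Sum>\<gamma>\<in>\<Delta>. of_bool (\<gamma> = \<alpha>)) = (1::real)"
    using \<alpha>R by (simp add: of_bool_def)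
  have "4 * (casimir \<alpha> \<bullet> \<alpha>) = (\<Sum>\<gamma>\<in>\<Delta>. 4 * (\<gamma> \<bullet> \<alpha>)\<^sup>2)"
    unfolding casimir_def by (simp add: inner_sum_left sum_distrib_left power2_eq_square)
  also have "\<dots> = (\<alpha> \<bullet> \<alpha>)\<^sup>2 * ((\<Sum>\<gamma>\<in>\<Delta>. of_bool (\<gamma> - \<alpha> \<in> \<Delta>)) + (\<Sum>\<gamma>\<in>\<Delta>. of_bool (- \<gamma> - \<alpha> \<in> \<Delta>))
      + 4 * (\<Sum>\<gamma>\<in>\<Delta>. of_bool (\<gamma> = \<alpha>)) + 4 * (\<Sum>\<gamma>\<in>\<Delta>. of_bool (- \<gamma> = \<alpha>)))"
    unfolding sum_distrib_left sum.distrib[symmetric]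
    by (intro sum.cong HOL.refl) (simp add: simply_laced_inner[OF sl \<alpha>R])
  also have "\<dots> = (\<alpha> \<bullet> \<alpha>)\<^sup>2 * (2 * real (card ?D) + 8)"
    unfolding sum_uminus_roots[of "\<lambda>\<gamma>. of_bool (\<gamma> - \<alpha> \<in> \<Delta>)"] sum_uminus_roots[of "\<lambda>\<gamma>. of_bool (\<gamma> = \<alpha>)"]
      sumD sum\<alpha> by simp
  finally have c: "4 * (casimir \<alpha> \<bullet> \<alpha>) = (\<alpha> \<bullet> \<alpha>)\<^sup>2 * (2 * real (card ?D) + 8)" .
  have "?D = ?E \<union> (\<lambda>\<gamma>. \<alpha> - \<gamma>) ` ?E"
  proof (intro equalityI subsetI)
    fix \<gamma> assume \<gamma>: "\<gamma> \<in> ?D"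
    show "\<gamma> \<in> ?E \<union> (\<lambda>\<gamma>. \<alpha> - \<gamma>) ` ?E"
    proof (cases "\<gamma> \<in> P")
      case True
      then show ?thesis using \<gamma> by blast
    next
      case False
      then have "- \<gamma> \<in> P" using \<gamma> pos_cases by blast
      moreover have R: "\<alpha> - \<gamma> \<in> \<Delta>" using \<gamma> root_diff_commute by blast
      ultimately have "\<alpha> - \<gamma> \<in> P" using pos_add[OF simple_pos[OF \<alpha>], of "- \<gamma>"] by simp
      moreover have "\<alpha> - \<gamma> - \<alpha> \<in> \<Delta>" using \<gamma> root_uminus by simp
      moreover have "\<gamma> = \<alpha> - (\<alpha> - \<gamma>)" by simp
      ultimately show ?thesis by blast
    qed
  next
    fix \<gamma> assume "\<gamma> \<in> ?E \<union> (\<lambda>\<gamma>. \<alpha> - \<gamma>) ` ?E"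
    then show "\<gamma> \<in> ?D" using pos_root root_uminus root_diff_commute by auto
  qed
  moreover have "?E \<inter> (\<lambda>\<gamma>. \<alpha> - \<gamma>) ` ?E = {}"
  proof -
    have "\<alpha> - \<gamma> \<notin> P" if "\<gamma> \<in> ?E" for \<gamma>
      using pos_diff_simple[of \<gamma> \<alpha>] \<alpha> that pos_not_neg[of "\<gamma> - \<alpha>"] by simp
    then show ?thesis by blast
  qed
  ultimately have "card ?D = card ?E + card ((\<lambda>\<gamma>. \<alpha> - \<gamma>) ` ?E)"
    by (simp add: card_Un_disjoint)
  also have "card ((\<lambda>\<gamma>. \<alpha> - \<gamma>) ` ?E) = card ?E" by (intro card_image) (simp add: inj_on_def)
  finally show ?thesis using c by (simp add: algebra_simps)
qed

lemma card_roots: "card \<Delta> = 2 * card P"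
proof -
  have "\<Delta> = P \<union> uminus ` P"
  proof (intro equalityI subsetI)
    fix \<gamma> assume "\<gamma> \<in> \<Delta>"
    then show "\<gamma> \<in> P \<union> uminus ` P"
      by (rule pos_cases) (auto intro: image_eqI[of _ _ "- \<gamma>"])
  qed (use pos_root root_uminus in auto)
  moreover have "P \<inter> uminus ` P = {}" using pos_not_neg by force
  ultimately have "card \<Delta> = card P + card (uminus ` P)" by (metis card_Un_disjoint finite_imageI finite_pos)
  then show ?thesis by (simp add: card_image)
qed

text \<open>Divided by the common squared length \<open>N\<close>, the trace identity has 2 for each
  simple root and 1 for each edge on one side, and the number of roots on the other.\<close>

lemma simply_laced_card_edges:
  assumes sl: "simply_laced \<Delta>"
  shows "2 * card P = 2 * DIM('a) + (\<Sum>\<gamma>\<in>P. card (down \<gamma>))"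
proof (cases "P = {}")
  case True
  then have "S = {}" using simple_pos by blast
  then show ?thesis using True card_simple by simp
next
  case False
  then obtain \<theta> where \<theta>: "\<theta> \<in> \<Delta>" using pos_root by blast
  define N where "N = \<theta> \<bullet> \<theta>"
  have N: "N > 0" unfolding N_def using root_norm_pos[OF \<theta>] .
  have norm: "\<delta> \<bullet> \<delta> = N" if "\<delta> \<in> \<Delta>" for \<delta>
    using sl \<theta> that unfolding simply_laced_def N_def by (metis norm_eq)
  have "2 * real (card P) * N = (\<Sum>\<gamma>\<in>\<Delta>. \<gamma> \<bullet> \<gamma>)"
    using norm card_roots by simp
  also have "\<dots> = (\<Sum>\<alpha>\<in>S. N * (2 + real (card {\<gamma> \<in> P. \<gamma> - \<alpha> \<in> \<Delta>})))"
    unfolding sum_norm_eq_casimir using N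
    by (intro sum.cong HOL.refl) (simp add: simply_laced_casimir[OF sl] norm simple_root power2_eq_square)
  also have "\<dots> = N * (2 * real (card S) + (\<Sum>\<alpha>\<in>S. real (card {\<gamma> \<in> P. \<gamma> - \<alpha> \<in> \<Delta>})))"
    unfolding sum_distrib_left[symmetric] by (simp add: sum.distrib)
  finally have e: "2 * real (card P) = 2 * real (card S) + (\<Sum>\<alpha>\<in>S. real (card {\<gamma> \<in> P. \<gamma> - \<alpha> \<in> \<Delta>}))"
    using N by simp
  \<comment> \<open>Edges of the Hasse diagram are counted by their label \<alpha> and by their
    upper end \<gamma>.\<close>
  have "(\<Sum>\<alpha>\<in>S. card {\<gamma> \<in> P. \<gamma> - \<alpha> \<in> \<Delta>}) = (\<Sum>\<alpha>\<in>S. \<Sum>\<gamma>\<in>P. of_bool (\<gamma> - \<alpha> \<in> \<Delta>))"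
    by (simp add: of_bool_def Int_def flip: sum.inter_filter)
  also have "\<dots> = (\<Sum>\<gamma>\<in>P. \<Sum>\<alpha>\<in>S. of_bool (\<gamma> - \<alpha> \<in> \<Delta>))" by (rule sum.swap)
  also have "\<dots> = (\<Sum>\<gamma>\<in>P. card (down \<gamma>))"
    unfolding down_def by (simp add: of_bool_def Int_def flip: sum.inter_filter)
  finally have swap: "(\<Sum>\<alpha>\<in>S. card {\<gamma> \<in> P. \<gamma> - \<alpha> \<in> \<Delta>}) = (\<Sum>\<gamma>\<in>P. card (down \<gamma>))" .
  have "real (2 * card P) = real (2 * card S + (\<Sum>\<gamma>\<in>P. card (down \<gamma>)))"
    unfolding swap[symmetric] of_nat_add of_nat_mult of_nat_sum of_nat_numeral by (rule e)
  then show ?thesis unfolding card_simple of_nat_eq_iff .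
qed

text \<open>With \<open>a i\<close> the number of positive roots covering \<open>i\<close> others,
  the edge count reads 2(a 0 + a 1 + a 2 + a 3) = 2 a 0 + (a 1 + 2 a 2 + 3 a 3).\<close>

lemma simply_laced_coeff_1_eq_coeff_3:
  assumes sl: "simply_laced \<Delta>"
  shows "coeff (upper_poly P le) 1 = coeff (upper_poly P le) 3"
proof -
  define a where "a i = card {\<gamma> \<in> P. card (down \<gamma>) = i}" for i
  have bound: "card (down \<gamma>) \<in> {..3}" if "\<gamma> \<in> P" for \<gamma>
    using down_card[OF pos_root[OF that] subset_refl] by simp
  have "(\<Sum>\<gamma>\<in>P. h (card (down \<gamma>))) = (\<Sum>i\<le>3. a i * h i)" for h :: "nat \<Rightarrow> nat"
  proof -
    have "(\<Sum>\<gamma>\<in>P. h (card (down \<gamma>))) = (\<Sum>i\<le>3. \<Sum>\<gamma> | \<gamma> \<in> P \<and> card (down \<gamma>) = i. h (card (down \<gamma>)))"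
      using bound by (intro sum.group[symmetric]) auto
    also have "\<dots> = (\<Sum>i\<le>3. a i * h i)" unfolding a_def by simp
    finally show ?thesis .
  qed
  from this[of "\<lambda>_. 1"] this[of "\<lambda>i. i"]
  have "card P = a 0 + a 1 + a 2 + a 3" "(\<Sum>\<gamma>\<in>P. card (down \<gamma>)) = a 1 + 2 * a 2 + 3 * a 3"
    by (simp_all add: eval_nat_numeral)
  moreover have "a 0 = DIM('a)" using coeff_upper_0 unfolding coeff_upper a_def by simp
  ultimately have "a 1 = a 3" using simply_laced_card_edges[OF sl] by simp
  then show ?thesis unfolding coeff_upper a_def by simp
qed

end

theorem theorem2p1:
  fixes \<Delta> P :: "'a::euclidean_space set" and n :: nat
  assumes "irreducible_root_system \<Delta>"
    and "n = DIM('a)"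
    and "positive_roots \<Delta> P"
  shows "(degree (upper_poly P (root_order P)) \<le> 3 \<and>
          degree (lower_poly P (root_order P)) \<le> 3) \<and>
         coeff (upper_poly P (root_order P)) 3 = coeff (lower_poly P (root_order P)) 3 \<and>
         (simply_laced \<Delta> \<longrightarrow>
          coeff (upper_poly P (root_order P)) 1 = coeff (upper_poly P (root_order P)) 3) \<and>
         deviation_poly P (root_order P) = [:int n - 1:]"
proof -
  obtain v where v: "\<forall>\<alpha>\<in>\<Delta>. v \<bullet> \<alpha> \<noteq> 0" "P = {\<alpha> \<in> \<Delta>. v \<bullet> \<alpha> > 0}"
    using assms(3) unfolding positive_roots_def by blast
  interpret based_root_system \<Delta> P v
    by unfold_locales (use v assms(1) in \<open>auto simp: irreducible_root_system_def\<close>)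
  show ?thesis
    using degree_upper degree_lower coeff_3_eq simply_laced_coeff_1_eq_coeff_3
      deviation_poly_root_order[OF assms(1)] assms(2) by blast
qed

end
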